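(* Let $(T(t))_{t\ge 0}$ be a $C_0$-semigroup on a complex Banach lattice $E$ whose generator $A$ is real. Let $0\le u\in E$ be such that $(T(t))_{t\ge0}$ is ultracontractive with respect to the principal ideal $E_u$, i.e., there exist $C\ge 1$ and $\alpha>0$ such that $T(t)E\subseteq E_u$ and $\|T(t)\|_{E\to E_u}\le Ct^{-\alpha}$ for all $t\in(0,1]$. Moreover, assume that there exists $C\ge 1$ such that $\|T(t)\|_{E_u\to E_u}\le C$ for all $t\in(0,1]$, and let $B:E\to E$ be a bounded operator leaving $E_u$ invariant. If $\lambda_0\in\sigma(A)\cap\mathbb{R}$ is a pole of the resolvent $\mathcal{R}(\cdot,A)$ and an algebraically simple eigenvalue with an eigenvector $v_0$ satisfying $v_0\ge cu$ for some constant $c>0$, then there exists $\delta>0$ such that for all $\kappa\in(-\delta,\delta)$, the operator $A+\kappa B$ has an algebraically simple eigenvalue $\lambda(\kappa)$ with an eigenvector $v(\kappa)\ge (c/2)u$.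
   Context: A complex Banach lattice $E$ is the complexification of a real Banach lattice; $E_{\mathbb{R}}$ denotes its real part and $E_+$ its positive cone. A linear operator $A:\operatorname{dom}(A)\subseteq E\to E$ is called real if $\operatorname{dom}(A)=\operatorname{dom}(A)\cap E_{\mathbb{R}}+i\operatorname{dom}(A)\cap E_{\mathbb{R}}$ and $A(\operatorname{dom}(A)\cap E_{\mathbb{R}})\subseteq E_{\mathbb{R}}$. For $u\in E_+$, the principal ideal generated by $u$ is the Banach space $E_u=\{x\in E:\ |x|\le cu \text{ for some } c>0\}$ with the gauge norm $\|x\|_{E_u}=\inf\{c>0: |x|\le cu\}$; it embeds continuously into $E$. $\sigma(A)$ denotes the spectrum of $A$, and $\mathcal{R}(\lambda,A)=(\lambda-A)^{-1}$ for $\lambda$ in the resolvent set $\mathbb{C}\setminus\sigma(A)$; $\lambda_0\in\sigma(A)$ is a pole of the resolvent if the analytic map $\lambda\mapsto\mathcal{R}(\lambda,A)$ has a pole at $\lambda_0$. An eigenvalue $\lambda_0$ of $A$ is algebraically simple if its generalised eigenspace $\bigcup_{m\in\mathbb{N}}\ker[(\lambda_0-A)^m]$ has dimension one.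
   Formalization: The claim fails for non-real B (e.g. E = C², A = [[-1/2,1/2],[1/2,-1/2]], B = diag(i,-i), u = (1,1)), so v(κ) ≥ (c/2)u is asserted only when the bounded operator B is real; for general B the eigenvector satisfies Re v(κ) ≥ (c/2)u. *)

theory Defs
  imports "HOL-Analysis.Analysis" "HOL-Library.Lattice_Algebras"
begin

section \<open>Real Banach lattices\<close>

class banach_lattice = banach + lattice_ab_group_add_abs + ordered_real_vector +
  assumes norm_abs_mono: "\<bar>x\<bar> \<le> \<bar>y\<bar> \<Longrightarrow> norm x \<le> norm y"

lemma norm_abs_lattice [simp]: "norm \<bar>x\<bar> = norm (x :: 'a::banach_lattice)"
  by (intro order.antisym norm_abs_mono) simp_all

lemma norm_mono_nonneg: "0 \<le> x \<Longrightarrow> x \<le> y \<Longrightarrow> norm x \<le> norm (y :: 'a::banach_lattice)"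
  by (rule norm_abs_mono) (simp add: order_trans[of 0 x y])

lemma banach_lattice_LIMSEQ_nonneg:
  fixes x :: "'a::banach_lattice"
  assumes "X \<longlonglongrightarrow> x" and "\<And>n. 0 \<le> X n"
  shows "0 \<le> x"
proof -
  have "norm (sup (- x) 0) \<le> norm (X n - x)" for n
  proof -
    have "- x \<le> \<bar>X n - x\<bar>"
      using abs_ge_self[of "X n - x"] assms(2)[of n]
      by (metis add_increasing diff_conv_add_uminus order_trans order_refl)
    then have "sup (- x) 0 \<le> \<bar>X n - x\<bar>" by simp
    then have "norm (sup (- x) 0) \<le> norm \<bar>X n - x\<bar>"
      by (intro norm_mono_nonneg) simp_all
    then show ?thesis by simp
  qed
  moreover have "(\<lambda>n. norm (X n - x)) \<longlonglongrightarrow> 0"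
    using assms(1) by (simp add: LIM_zero tendsto_norm_zero)
  ultimately have "norm (sup (- x) 0) \<le> 0"
    by (meson LIMSEQ_le_const)
  then have "sup (- x) 0 = 0" by simp
  then have "- x \<le> 0" by (metis sup_ge1)
  then show ?thesis by simp
qed

lemma banach_lattice_LIMSEQ_le:
  fixes x y :: "'a::banach_lattice"
  assumes "X \<longlonglongrightarrow> x" "Y \<longlonglongrightarrow> y" and "\<And>n. X n \<le> Y n"
  shows "x \<le> y"
  using banach_lattice_LIMSEQ_nonneg[OF tendsto_diff[OF assms(2,1)]] assms(3) by simp

lemma abs_scaleR_lattice:
  fixes x :: "'a::banach_lattice"
  shows "\<bar>a *\<^sub>R x\<bar> = \<bar>a\<bar> *\<^sub>R \<bar>x\<bar>"
proof -
  have le: "\<bar>b *\<^sub>R y\<bar> \<le> \<bar>b\<bar> *\<^sub>R \<bar>y\<bar>" for b and y :: 'a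
  proof -
    have "b *\<^sub>R y \<le> \<bar>b\<bar> *\<^sub>R \<bar>y\<bar> \<and> - (b *\<^sub>R y) \<le> \<bar>b\<bar> *\<^sub>R \<bar>y\<bar>"
    proof (cases "0 \<le> b")
      case True
      have "b *\<^sub>R y \<le> b *\<^sub>R \<bar>y\<bar>" "b *\<^sub>R (- y) \<le> b *\<^sub>R \<bar>y\<bar>"
        using True by (rule scaleR_left_mono[rotated], simp add: abs_ge_self abs_ge_minus_self)+
      then show ?thesis using True by simp
    next
      case False
      have "(- b) *\<^sub>R y \<le> (- b) *\<^sub>R \<bar>y\<bar>" "(- b) *\<^sub>R (- y) \<le> (- b) *\<^sub>R \<bar>y\<bar>"
        using False by (intro scaleR_left_mono abs_ge_self abs_ge_minus_self; simp)+
      then show ?thesis using False by simp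
    qed
    then show ?thesis by (simp add: abs_le_iff)
  qed
  show ?thesis
  proof (cases "a = 0")
    case False
    have "\<bar>x\<bar> \<le> \<bar>inverse a\<bar> *\<^sub>R \<bar>a *\<^sub>R x\<bar>"
      using le[of "inverse a" "a *\<^sub>R x"] False by simp
    then have "\<bar>a\<bar> *\<^sub>R \<bar>x\<bar> \<le> \<bar>a\<bar> *\<^sub>R (\<bar>inverse a\<bar> *\<^sub>R \<bar>a *\<^sub>R x\<bar>)"
      by (rule scaleR_left_mono) simp
    then have "\<bar>a\<bar> *\<^sub>R \<bar>x\<bar> \<le> \<bar>a *\<^sub>R x\<bar>"
      using False by (simp add: abs_mult[symmetric])
    with le[of a x] show ?thesis by (rule order.antisym)
  qed simp
qed

section \<open>Complexification of a real Banach lattice\<close>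

datatype 'a complexification = Cplx (real_part: 'a) (imag_part: 'a)

lemma complexification_eq_iff:
  "z = w \<longleftrightarrow> real_part z = real_part w \<and> imag_part z = imag_part w"
  by (cases z; cases w) simp

definition of_re :: "'a::zero \<Rightarrow> 'a complexification" where
  "of_re x = Cplx x 0"

definition real_space :: "'a::zero complexification set" where
  "real_space = range of_re"

lemma of_re_simps [simp]: "real_part (of_re x) = x" "imag_part (of_re x) = 0"
  by (simp_all add: of_re_def)

lemma mem_real_space_iff: "z \<in> real_space \<longleftrightarrow> imag_part z = 0"
  by (cases z) (auto simp: real_space_def of_re_def image_iff)

instantiation complexification :: (ab_group_add) ab_group_add
begin

definition "0 = Cplx 0 0"
definition "z + w = Cplx (real_part z + real_part w) (imag_part z + imag_part w)"
definition "z - w = Cplx (real_part z - real_part w) (imag_part z - imag_part w)"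
definition "- z = Cplx (- real_part z) (- imag_part z)" for z :: "'a complexification"

instance
  by standard
    (simp_all add: complexification_eq_iff zero_complexification_def plus_complexification_def
      minus_complexification_def uminus_complexification_def algebra_simps)

end

lemma complexification_part_simps [simp]:
  "real_part 0 = 0" "imag_part 0 = 0"
  "real_part (z + w) = real_part z + real_part w" "imag_part (z + w) = imag_part z + imag_part w"
  "real_part (z - w) = real_part z - real_part w" "imag_part (z - w) = imag_part z - imag_part w"
  "real_part (- z) = - real_part z" "imag_part (- z) = - imag_part z"
  by (simp_all add: zero_complexification_def plus_complexification_def
      minus_complexification_def uminus_complexification_def)

instantiation complexification :: (real_vector) real_vector
begin

definition "scaleR a z = Cplx (a *\<^sub>R real_part z) (a *\<^sub>R imag_part z)"

instance
  by standard (simp_all add: complexification_eq_iff scaleR_complexification_def algebra_simps)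

end

lemma complexification_scaleR_simps [simp]:
  "real_part (a *\<^sub>R z) = a *\<^sub>R real_part z" "imag_part (a *\<^sub>R z) = a *\<^sub>R imag_part z"
  by (simp_all add: scaleR_complexification_def)

definition scaleC :: "complex \<Rightarrow> 'a::real_vector complexification \<Rightarrow> 'a complexification"
    (infixr \<open>*\<^sub>C\<close> 75) where
  "c *\<^sub>C z = Cplx (Re c *\<^sub>R real_part z - Im c *\<^sub>R imag_part z)
                (Re c *\<^sub>R imag_part z + Im c *\<^sub>R real_part z)"

lemma complexification_scaleC_simps [simp]:
  "real_part (c *\<^sub>C z) = Re c *\<^sub>R real_part z - Im c *\<^sub>R imag_part z"
  "imag_part (c *\<^sub>C z) = Re c *\<^sub>R imag_part z + Im c *\<^sub>R real_part z"
  by (simp_all add: scaleC_def)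

lemma scaleC_of_real: "complex_of_real a *\<^sub>C z = a *\<^sub>R z"
  by (simp add: complexification_eq_iff)

global_interpretation complexification: vector_space scaleC
  by unfold_locales (simp_all add: complexification_eq_iff algebra_simps)

text \<open>As for \<open>complex\<close> in \<open>HOL-Library.Complex_Order\<close>, \<open>z \<le> w\<close> means that \<open>w - z\<close> is a positive
  element of the real part; comparable elements have the same imaginary part.\<close>

instantiation complexification :: (ordered_real_vector) ordered_real_vector
begin

definition "z \<le> w \<longleftrightarrow> real_part z \<le> real_part w \<and> imag_part z = imag_part w"
definition "z < w \<longleftrightarrow> z \<le> w \<and> \<not> w \<le> z" for z w :: "'a complexification"

instance
  by standard
    (auto simp: less_eq_complexification_def less_complexification_def complexification_eq_iff
      intro: scaleR_left_mono scaleR_right_mono)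

end

text \<open>\<open>|x + iy| = sup {cos \<theta> x + sin \<theta> y | \<theta>}\<close>; this supremum exists in every Banach lattice,
  see \<open>modulus_upper\<close> and \<open>modulus_least\<close>.\<close>

definition modulus :: "'a::banach_lattice complexification \<Rightarrow> 'a" where
  "modulus z = (LEAST s. \<forall>\<theta>. cos \<theta> *\<^sub>R real_part z + sin \<theta> *\<^sub>R imag_part z \<le> s)"

lemma modulus_sup_exists:
  fixes x y :: "'a::banach_lattice"
  shows "\<exists>s. (\<forall>\<theta>. cos \<theta> *\<^sub>R x + sin \<theta> *\<^sub>R y \<le> s) \<and>
             (\<forall>w. (\<forall>\<theta>. cos \<theta> *\<^sub>R x + sin \<theta> *\<^sub>R y \<le> w) \<longrightarrow> s \<le> w)"
proof -
  define f where "f \<theta> = cos \<theta> *\<^sub>R x + sin \<theta> *\<^sub>R y" for \<theta>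
  define K where "K = \<bar>x\<bar> + \<bar>y\<bar>"
  have K0: "0 \<le> K" by (simp add: K_def)
  have lip: "f s \<le> f t + \<bar>s - t\<bar> *\<^sub>R K" for s t
  proof -
    have c: "\<bar>cos s - cos t\<bar> \<le> \<bar>s - t\<bar>" for s t :: real
    proof -
      have "cos s - cos t = 2 * (sin ((s + t) / 2) * sin ((t - s) / 2))"
        by (simp add: cos_diff_cos)
      then have "\<bar>cos s - cos t\<bar> = 2 * (\<bar>sin ((s + t) / 2)\<bar> * \<bar>sin ((t - s) / 2)\<bar>)"
        by (simp add: abs_mult)
      also have "\<dots> \<le> 2 * (1 * \<bar>(t - s) / 2\<bar>)"
        by (intro mult_left_mono mult_mono abs_sin_x_le_abs_x) auto
      finally show ?thesis by (simp add: abs_minus_commute)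
    qed
    have sn: "\<bar>sin s - sin t\<bar> \<le> \<bar>s - t\<bar>"
      using c[of "pi/2 - s" "pi/2 - t"] by (simp add: cos_diff abs_minus_commute)
    have "f s - f t = (cos s - cos t) *\<^sub>R x + (sin s - sin t) *\<^sub>R y"
      by (simp add: f_def algebra_simps)
    also have "\<dots> \<le> \<bar>cos s - cos t\<bar> *\<^sub>R \<bar>x\<bar> + \<bar>sin s - sin t\<bar> *\<^sub>R \<bar>y\<bar>"
      by (intro add_mono) (metis abs_ge_self abs_scaleR_lattice)+
    also have "\<dots> \<le> \<bar>s - t\<bar> *\<^sub>R \<bar>x\<bar> + \<bar>s - t\<bar> *\<^sub>R \<bar>y\<bar>"
      by (intro add_mono scaleR_right_mono c sn) auto
    finally show ?thesis by (simp add: K_def algebra_simps)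
  qed
  define g where "g n k = f (2 * pi * real k / real (Suc n))" for n k
  define s where "s n = Sup_fin (g n ` {..n})" for n
  define e where "e n = 2 * pi / real (Suc n)" for n
  have e0: "e \<longlonglongrightarrow> 0"
    unfolding e_def by (rule LIMSEQ_Suc[OF lim_const_over_n])
  have f_le_s: "f \<theta> \<le> s n + e n *\<^sub>R K" for \<theta> n
  proof -
    obtain t where t: "0 \<le> t" "t < 2 * pi" "cos \<theta> = cos t" "sin \<theta> = sin t"
      using sincos_total_2pi[of "cos \<theta>" "sin \<theta>"] by (metis sin_cos_squared_add2)
    define r where "r = t * real (Suc n) / (2 * pi)"
    define k where "k = nat \<lfloor>r\<rfloor>"
    have r0: "0 \<le> r" using t by (simp add: r_def)
    have "r < real (Suc n)"
      using t(2) by (simp add: r_def field_simps del: of_nat_Suc)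
    then have k_le: "k \<le> n" unfolding k_def using r0 by linarith
    have kr: "real k \<le> r" "r < real k + 1" unfolding k_def using r0 by linarith+
    have "t - 2 * pi * real k / real (Suc n) = e n * (r - real k)"
      by (simp add: e_def r_def field_simps del: of_nat_Suc)
    moreover have "\<bar>e n * (r - real k)\<bar> \<le> e n * 1"
      unfolding abs_mult using kr by (intro mult_mono) (auto simp: e_def)
    ultimately have *: "\<bar>t - 2 * pi * real k / real (Suc n)\<bar> \<le> e n" by simp
    have "f \<theta> = f t" using t by (simp add: f_def)
    also have "\<dots> \<le> g n k + \<bar>t - 2 * pi * real k / real (Suc n)\<bar> *\<^sub>R K"
      unfolding g_def by (rule lip)
    also have "\<dots> \<le> s n + e n *\<^sub>R K"
      unfolding s_def using k_le *
      by (intro add_mono Sup_fin.coboundedI scaleR_right_mono K0) auto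
    finally show ?thesis .
  qed
  have s_le: "s n \<le> w" if "\<And>\<theta>. f \<theta> \<le> w" for n w
    unfolding s_def using that by (intro Sup_fin.boundedI) (auto simp: g_def)
  have s_diff: "\<bar>s m - s n\<bar> \<le> (e m + e n) *\<^sub>R K" for m n
  proof -
    have "s m - s n \<le> (e m + e n) *\<^sub>R K" for m n
    proof -
      have "s m \<le> s n + e n *\<^sub>R K" by (rule s_le) (rule f_le_s)
      moreover have "0 \<le> e m *\<^sub>R K" using K0 by (simp add: e_def scaleR_nonneg_nonneg)
      ultimately have "s m + 0 \<le> (s n + e n *\<^sub>R K) + e m *\<^sub>R K" by (rule add_mono)
      then show ?thesis by (simp add: algebra_simps)
    qed
    from this[of m n] this[of n m] show ?thesis
      by (intro abs_leI) (simp_all add: add.commute)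
  qed
  have "Cauchy s"
  proof (rule metric_CauchyI)
    fix r :: real assume "0 < r"
    have "(\<lambda>n. e n * norm K) \<longlonglongrightarrow> 0" using tendsto_mult_left_zero[OF e0] .
    then have "\<forall>\<^sub>F n in sequentially. e n * norm K < r / 2"
      using \<open>0 < r\<close> by (intro order_tendstoD(2)) auto
    then obtain N where N: "\<And>n. n \<ge> N \<Longrightarrow> e n * norm K < r / 2"
      by (auto simp: eventually_sequentially)
    have "dist (s m) (s n) < r" if "m \<ge> N" "n \<ge> N" for m n
    proof -
      have "0 \<le> e m + e n" by (simp add: e_def)
      then have "0 \<le> (e m + e n) *\<^sub>R K" using K0 by (rule scaleR_nonneg_nonneg)
      then have "norm (s m - s n) \<le> norm ((e m + e n) *\<^sub>R K)"
        using s_diff[of m n] by (intro norm_abs_mono) simp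
      also have "\<dots> = e m * norm K + e n * norm K"
        using \<open>0 \<le> e m + e n\<close> by (simp only: norm_scaleR abs_of_nonneg distrib_right)
      finally show ?thesis using N[OF that(1)] N[OF that(2)] by (simp add: dist_norm)
    qed
    then show "\<exists>N. \<forall>m\<ge>N. \<forall>n\<ge>N. dist (s m) (s n) < r" by blast
  qed
  then obtain L where L: "s \<longlonglongrightarrow> L" using Cauchy_convergent convergent_def by blast
  have "(\<lambda>n. s n + e n *\<^sub>R K) \<longlonglongrightarrow> L + 0 *\<^sub>R K" by (intro tendsto_intros L e0)
  then have "f \<theta> \<le> L" for \<theta>
    using banach_lattice_LIMSEQ_le[OF tendsto_const[of "f \<theta>"], of "\<lambda>n. s n + e n *\<^sub>R K" L] f_le_s
    by simp
  moreover have "L \<le> w" if "\<And>\<theta>. f \<theta> \<le> w" for w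
    using banach_lattice_LIMSEQ_le[OF L tendsto_const[of w]] s_le[OF that] by simp
  ultimately show ?thesis by (auto simp: f_def)
qed

lemma
  shows modulus_upper: "cos \<theta> *\<^sub>R real_part z + sin \<theta> *\<^sub>R imag_part z \<le> modulus z"
    and modulus_least:
      "(\<And>\<theta>. cos \<theta> *\<^sub>R real_part z + sin \<theta> *\<^sub>R imag_part z \<le> w) \<Longrightarrow> modulus z \<le> w"
proof -
  obtain s where s: "\<forall>\<theta>. cos \<theta> *\<^sub>R real_part z + sin \<theta> *\<^sub>R imag_part z \<le> s"
    "\<forall>w. (\<forall>\<theta>. cos \<theta> *\<^sub>R real_part z + sin \<theta> *\<^sub>R imag_part z \<le> w) \<longrightarrow> s \<le> w"
    using modulus_sup_exists by blast
  have "modulus z = s"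
    unfolding modulus_def using s by (intro Least_equality) auto
  then show "cos \<theta> *\<^sub>R real_part z + sin \<theta> *\<^sub>R imag_part z \<le> modulus z"
    "(\<And>\<theta>. cos \<theta> *\<^sub>R real_part z + sin \<theta> *\<^sub>R imag_part z \<le> w) \<Longrightarrow> modulus z \<le> w"
    using s by auto
qed

lemma abs_real_part_le_modulus: "\<bar>real_part z\<bar> \<le> modulus z"
  using modulus_upper[of 0 z] modulus_upper[of pi z] by (intro abs_leI) simp_all

lemma abs_imag_part_le_modulus: "\<bar>imag_part z\<bar> \<le> modulus z"
  using modulus_upper[of "pi/2" z] modulus_upper[of "- (pi/2)" z]
  by (intro abs_leI) simp_all

lemma modulus_nonneg [simp]: "0 \<le> modulus z"
  using abs_real_part_le_modulus[of z] abs_ge_zero order_trans by blast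

lemma modulus_le_abs_parts: "modulus z \<le> \<bar>real_part z\<bar> + \<bar>imag_part z\<bar>"
proof (rule modulus_least)
  fix \<theta>
  have *: "a *\<^sub>R x \<le> \<bar>x\<bar>" if "\<bar>a\<bar> \<le> 1" for a and x :: 'a
  proof -
    have "a *\<^sub>R x \<le> \<bar>a\<bar> *\<^sub>R \<bar>x\<bar>" by (metis abs_ge_self abs_scaleR_lattice)
    also have "\<dots> \<le> 1 *\<^sub>R \<bar>x\<bar>" using that by (intro scaleR_right_mono) auto
    finally show ?thesis by simp
  qed
  show "cos \<theta> *\<^sub>R real_part z + sin \<theta> *\<^sub>R imag_part z \<le> \<bar>real_part z\<bar> + \<bar>imag_part z\<bar>"
    by (intro add_mono *) auto
qed

lemma modulus_triangle: "modulus (z + w) \<le> modulus z + modulus w"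
proof (rule modulus_least)
  fix \<theta>
  show "cos \<theta> *\<^sub>R real_part (z + w) + sin \<theta> *\<^sub>R imag_part (z + w) \<le> modulus z + modulus w"
    using add_mono[OF modulus_upper[of \<theta> z] modulus_upper[of \<theta> w]] by (simp add: algebra_simps)
qed

lemma modulus_scaleC: "modulus (c *\<^sub>C z) = cmod c *\<^sub>R modulus z"
proof -
  have le: "modulus (c *\<^sub>C z) \<le> cmod c *\<^sub>R modulus z" for c and z :: "'a complexification"
  proof (rule modulus_least)
    fix \<theta>
    have c: "Re c = cmod c * cos (Arg c)" "Im c = cmod c * sin (Arg c)"
      by (metis Re_rcis rcis_cmod_Arg, metis Im_rcis rcis_cmod_Arg)
    have "cos \<theta> *\<^sub>R real_part (c *\<^sub>C z) + sin \<theta> *\<^sub>R imag_part (c *\<^sub>C z)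
        = cmod c *\<^sub>R (cos (\<theta> - Arg c) *\<^sub>R real_part z + sin (\<theta> - Arg c) *\<^sub>R imag_part z)"
      by (simp add: c cos_diff sin_diff algebra_simps)
    also have "\<dots> \<le> cmod c *\<^sub>R modulus z"
      by (intro scaleR_left_mono modulus_upper) simp
    finally show "cos \<theta> *\<^sub>R real_part (c *\<^sub>C z) + sin \<theta> *\<^sub>R imag_part (c *\<^sub>C z)
        \<le> cmod c *\<^sub>R modulus z" .
  qed
  show ?thesis
  proof (cases "c = 0")
    case True
    have "modulus (0 :: 'a complexification) \<le> 0" by (rule modulus_least) simp
    then have "modulus (0 :: 'a complexification) = 0" by (intro order.antisym) auto
    then show ?thesis using True by simp
  next
    case False
    have "modulus z \<le> cmod (inverse c) *\<^sub>R modulus (c *\<^sub>C z)"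
      using le[of "inverse c" "c *\<^sub>C z"] False by simp
    then have "cmod c *\<^sub>R modulus z \<le> cmod c *\<^sub>R (cmod (inverse c) *\<^sub>R modulus (c *\<^sub>C z))"
      by (rule scaleR_left_mono) simp
    also have "\<dots> = modulus (c *\<^sub>C z)" using False by (simp add: norm_inverse)
    finally show ?thesis using le[of c z] by (intro order.antisym)
  qed
qed

lemma modulus_scaleR: "modulus (a *\<^sub>R z) = \<bar>a\<bar> *\<^sub>R modulus z"
  using modulus_scaleC[of "complex_of_real a" z] by (simp add: scaleC_of_real)

lemma modulus_of_re: "modulus (of_re x) = \<bar>x\<bar>"
  using modulus_le_abs_parts[of "of_re x"] abs_real_part_le_modulus[of "of_re x"]
  by (intro order.antisym) simp_all

instantiation complexification :: (banach_lattice) real_normed_vector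
begin

definition "norm z = norm (modulus z)"
definition "dist z w = norm (z - w)" for z w :: "'a complexification"
definition "sgn z = z /\<^sub>R norm z" for z :: "'a complexification"
definition [code del]:
  "(uniformity :: ('a complexification \<times> 'a complexification) filter) =
    (INF e\<in>{0 <..}. principal {(x, y). dist x y < e})"
definition [code del]:
  "open (U :: 'a complexification set) \<longleftrightarrow>
    (\<forall>x\<in>U. eventually (\<lambda>(x', y). x' = x \<longrightarrow> y \<in> U) uniformity)"

instance
proof
  fix z w :: "'a complexification" and a :: real
  have "z = 0" if "modulus z = 0"
    using abs_real_part_le_modulus[of z] abs_imag_part_le_modulus[of z] that
    by (simp add: complexification_eq_iff)
  moreover have "modulus (0 :: 'a complexification) = 0"
    using modulus_scaleR[of 0 "0 :: 'a complexification"] by simp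
  ultimately show "norm z = 0 \<longleftrightarrow> z = 0" by (auto simp: norm_complexification_def)
  have "norm (modulus (z + w)) \<le> norm (modulus z + modulus w)"
    by (intro norm_mono_nonneg modulus_triangle) simp
  also have "\<dots> \<le> norm (modulus z) + norm (modulus w)" by (rule norm_triangle_ineq)
  finally show "norm (z + w) \<le> norm z + norm w" by (simp add: norm_complexification_def)
  show "norm (a *\<^sub>R z) = \<bar>a\<bar> * norm z" by (simp add: norm_complexification_def modulus_scaleR)
qed (simp_all add: dist_complexification_def sgn_complexification_def
      uniformity_complexification_def open_complexification_def)

end

lemma norm_real_part_le: "norm (real_part z) \<le> norm z"
  unfolding norm_complexification_def
  using norm_abs_mono[of "real_part z" "modulus z"] abs_real_part_le_modulus[of z] by simp

lemma norm_imag_part_le: "norm (imag_part z) \<le> norm z"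
  unfolding norm_complexification_def
  using norm_abs_mono[of "imag_part z" "modulus z"] abs_imag_part_le_modulus[of z] by simp

lemma norm_le_norm_parts: "norm z \<le> norm (real_part z) + norm (imag_part z)"
proof -
  have "norm z \<le> norm (\<bar>real_part z\<bar> + \<bar>imag_part z\<bar>)"
    unfolding norm_complexification_def
    by (intro norm_mono_nonneg modulus_le_abs_parts) simp
  also have "\<dots> \<le> norm (real_part z) + norm (imag_part z)"
    using norm_triangle_ineq[of "\<bar>real_part z\<bar>" "\<bar>imag_part z\<bar>"] by simp
  finally show ?thesis .
qed

lemma norm_scaleC: "norm (c *\<^sub>C z) = cmod c * norm z"
  by (simp add: norm_complexification_def modulus_scaleC)

lemma norm_of_re: "norm (of_re x) = norm x"
  by (simp add: norm_complexification_def modulus_of_re)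

instance complexification :: (banach_lattice) banach
proof
  fix X :: "nat \<Rightarrow> 'a complexification"
  assume X: "Cauchy X"
  have "Cauchy (\<lambda>n. real_part (X n))" "Cauchy (\<lambda>n. imag_part (X n))"
    using X norm_real_part_le[of "X m - X n" for m n] norm_imag_part_le[of "X m - X n" for m n]
    by (auto simp: Cauchy_def dist_norm) (meson le_less_trans)+
  then obtain x y where xy: "(\<lambda>n. real_part (X n)) \<longlonglongrightarrow> x" "(\<lambda>n. imag_part (X n)) \<longlonglongrightarrow> y"
    by (meson Cauchy_convergent convergent_def)
  have "(\<lambda>n. norm (real_part (X n) - x) + norm (imag_part (X n) - y)) \<longlonglongrightarrow> 0 + 0"
    using xy by (intro tendsto_add tendsto_norm_zero LIM_zero)
  then have "(\<lambda>n. X n - Cplx x y) \<longlonglongrightarrow> 0"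
    using norm_le_norm_parts[of "X n - Cplx x y" for n]
    by (intro Lim_null_comparison[of "\<lambda>n. X n - Cplx x y"]) (auto intro: always_eventually)
  then have "X \<longlonglongrightarrow> Cplx x y" by (rule LIM_zero_cancel)
  then show "convergent X" by (rule convergentI)
qed

section \<open>Principal ideals and operator norms\<close>

definition principal_ideal :: "'a::banach_lattice \<Rightarrow> 'a complexification set" where
  "principal_ideal u = {z. \<exists>c>0. modulus z \<le> c *\<^sub>R u}"

definition gauge_norm :: "'a::banach_lattice \<Rightarrow> 'a complexification \<Rightarrow> real" where
  "gauge_norm u z = Inf {c. c > 0 \<and> modulus z \<le> c *\<^sub>R u}"

text \<open>The norm of \<open>S\<close> as an operator from \<open>X\<close>, normed by \<open>N\<close>, to a space normed by \<open>M\<close>. It is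
  extended-real valued so that unbounded operators have norm \<open>\<infinity>\<close>.\<close>

definition op_norm :: "('a \<Rightarrow> real) \<Rightarrow> 'a set \<Rightarrow> ('b \<Rightarrow> real) \<Rightarrow> ('a \<Rightarrow> 'b) \<Rightarrow> ennreal" where
  "op_norm N X M S = (SUP x\<in>{x \<in> X. N x \<le> 1}. ennreal (M (S x)))"

section \<open>Operators\<close>

text \<open>An unbounded operator is given by its domain \<open>D\<close> and a function \<open>A\<close>; the values of \<open>A\<close>
  outside \<open>D\<close> are irrelevant.\<close>

definition bounded_clinear ::
    "('a::banach_lattice complexification \<Rightarrow> 'a complexification) \<Rightarrow> bool" where
  "bounded_clinear S \<longleftrightarrow> bounded_linear S \<and> (\<forall>c x. S (c *\<^sub>C x) = c *\<^sub>C S x)"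

definition real_operator ::
    "'a::banach_lattice complexification set \<Rightarrow> ('a complexification \<Rightarrow> 'a complexification) \<Rightarrow> bool"
  where
  "real_operator D A \<longleftrightarrow>
     D = {x + \<i> *\<^sub>C y | x y. x \<in> D \<inter> real_space \<and> y \<in> D \<inter> real_space} \<and>
     A ` (D \<inter> real_space) \<subseteq> real_space"

definition C0_semigroup ::
    "(real \<Rightarrow> 'a::banach_lattice complexification \<Rightarrow> 'a complexification) \<Rightarrow> bool" where
  "C0_semigroup T \<longleftrightarrow>
     (\<forall>t\<ge>0. bounded_clinear (T t)) \<and>
     T 0 = id \<and>
     (\<forall>s\<ge>0. \<forall>t\<ge>0. T (s + t) = T s \<circ> T t) \<and>
     (\<forall>x. ((\<lambda>t. T t x) \<longlongrightarrow> x) (at_right 0))"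

definition generates ::
    "'a::banach_lattice complexification set \<Rightarrow> ('a complexification \<Rightarrow> 'a complexification) \<Rightarrow>
     (real \<Rightarrow> 'a complexification \<Rightarrow> 'a complexification) \<Rightarrow> bool" where
  "generates D A T \<longleftrightarrow>
     D = {x. \<exists>y. ((\<lambda>h. (T h x - x) /\<^sub>R h) \<longlongrightarrow> y) (at_right 0)} \<and>
     (\<forall>x\<in>D. ((\<lambda>h. (T h x - x) /\<^sub>R h) \<longlongrightarrow> A x) (at_right 0))"

definition ultracontractive ::
    "(real \<Rightarrow> 'a::banach_lattice complexification \<Rightarrow> 'a complexification) \<Rightarrow> 'a \<Rightarrow> bool" where
  "ultracontractive T u \<longleftrightarrow>
     (\<exists>C\<ge>1. \<exists>\<alpha>>0. \<forall>t\<in>{0<..1}.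
        range (T t) \<subseteq> principal_ideal u \<and>
        op_norm norm UNIV (gauge_norm u) (T t) \<le> ennreal (C * t powr (- \<alpha>)))"

section \<open>Spectral theory\<close>

definition resolvent ::
    "'a::banach_lattice complexification set \<Rightarrow> ('a complexification \<Rightarrow> 'a complexification) \<Rightarrow>
     complex \<Rightarrow> 'a complexification \<Rightarrow> 'a complexification" where
  "resolvent D A z = the_inv_into D (\<lambda>x. z *\<^sub>C x - A x)"

definition resolvent_set ::
    "'a::banach_lattice complexification set \<Rightarrow> ('a complexification \<Rightarrow> 'a complexification) \<Rightarrow>
     complex set" where
  "resolvent_set D A =
     {z. bij_betw (\<lambda>x. z *\<^sub>C x - A x) D UNIV \<and> bounded_clinear (resolvent D A z)}"

definition spectrum ::
    "'a::banach_lattice complexification set \<Rightarrow> ('a complexification \<Rightarrow> 'a complexification) \<Rightarrow>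
     complex set" where
  "spectrum D A = - resolvent_set D A"

lemma bounded_linear_scaleC: "bounded_linear (\<lambda>z. c *\<^sub>C z :: 'a::banach_lattice complexification)"
  by (rule bounded_linear_intro[of _ "cmod c"])
    (simp_all add: complexification_eq_iff norm_scaleC algebra_simps)

lift_definition blinfun_scaleC ::
    "complex \<Rightarrow> ('b::real_normed_vector \<Rightarrow>\<^sub>L 'a::banach_lattice complexification) \<Rightarrow>
     ('b \<Rightarrow>\<^sub>L 'a complexification)"
  is "\<lambda>c f x. c *\<^sub>C f x"
  by (rule bounded_linear_compose[OF bounded_linear_scaleC])

text \<open>A pole of order \<open>m \<ge> 1\<close>: near \<open>z0\<close>, \<open>F\<close> is the sum (in operator norm) of a Laurent series
  starting with the power \<open>-m\<close>; the coefficient of \<open>(z - z0) ^ (k - m)\<close> is \<open>U k\<close>.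
  Note that \<open>is_pole\<close> from \<open>HOL-Complex_Analysis\<close> only says \<open>norm (F z) \<rightarrow> \<infinity>\<close>. For vector-valued functions this does not
  exclude essential singularities, and it holds at every isolated point of a spectrum.\<close>

definition has_pole ::
    "(complex \<Rightarrow> 'b::real_normed_vector \<Rightarrow>\<^sub>L 'a::banach_lattice complexification) \<Rightarrow> complex \<Rightarrow> bool"
  where
  "has_pole F z0 \<longleftrightarrow>
     (\<exists>m\<ge>1. \<exists>U. U 0 \<noteq> 0 \<and>
        (\<forall>\<^sub>F z in at z0.
           (\<lambda>k. blinfun_scaleC ((z - z0) powi (int k - int m)) (U k)) sums F z))"

definition resolvent_has_pole ::
    "'a::banach_lattice complexification set \<Rightarrow> ('a complexification \<Rightarrow> 'a complexification) \<Rightarrow>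
     complex \<Rightarrow> bool" where
  "resolvent_has_pole D A z0 \<longleftrightarrow>
     (\<forall>\<^sub>F z in at z0. z \<in> resolvent_set D A) \<and> has_pole (\<lambda>z. Blinfun (resolvent D A z)) z0"

definition eigenvector ::
    "'a::banach_lattice complexification set \<Rightarrow> ('a complexification \<Rightarrow> 'a complexification) \<Rightarrow>
     complex \<Rightarrow> 'a complexification \<Rightarrow> bool" where
  "eigenvector D A z v \<longleftrightarrow> v \<in> D \<and> v \<noteq> 0 \<and> A v = z *\<^sub>C v"

definition eigenvalue ::
    "'a::banach_lattice complexification set \<Rightarrow> ('a complexification \<Rightarrow> 'a complexification) \<Rightarrow>
     complex \<Rightarrow> bool" where
  "eigenvalue D A z \<longleftrightarrow> (\<exists>v. eigenvector D A z v)"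

fun power_domain :: "'a set \<Rightarrow> ('a \<Rightarrow> 'a) \<Rightarrow> nat \<Rightarrow> 'a set" where
  "power_domain D S 0 = UNIV"
| "power_domain D S (Suc m) = {x \<in> D. S x \<in> power_domain D S m}"

definition generalised_eigenspace ::
    "'a::banach_lattice complexification set \<Rightarrow> ('a complexification \<Rightarrow> 'a complexification) \<Rightarrow>
     complex \<Rightarrow> 'a complexification set" where
  "generalised_eigenspace D A z =
     (\<Union>m. {x \<in> power_domain D (\<lambda>x. z *\<^sub>C x - A x) m. ((\<lambda>x. z *\<^sub>C x - A x) ^^ m) x = 0})"

definition algebraically_simple_eigenvalue ::
    "'a::banach_lattice complexification set \<Rightarrow> ('a complexification \<Rightarrow> 'a complexification) \<Rightarrow>
     complex \<Rightarrow> bool" where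
  "algebraically_simple_eigenvalue D A z \<longleftrightarrow>
     eigenvalue D A z \<and> complexification.dim (generalised_eigenspace D A z) = 1"

end

theory Submission
  imports Defs
begin

text \<open>Since \<open>\<mu>0\<close> is algebraically simple, the pole has order one and the first two Laurent coefficients
  yield the rank-one spectral projection \<open>P = \<phi>(\<cdot>) v0\<close> and the reduced resolvent \<open>S\<close> with
  \<open>(\<mu>0 - A) S = I - P\<close>. The eigenvalue equation for \<open>A + \<kappa> B\<close> under the normalisation \<open>\<phi> v = 1\<close>
  becomes the fixed point equation \<open>v = v0 + \<kappa> (S B v - \<phi>(B v) S v)\<close>. The operators \<open>S\<close> and \<open>B\<close> are
  bounded on \<open>E\<^sub>u\<close>, so for small \<open>\<kappa>\<close> the right-hand side maps \<open>{v. |v - v0| \<le> (c/2) u}\<close> into itself.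
  This set is closed in \<open>E\<close> and the map contracts the norm of \<open>E\<close>, so Banach's fixed point theorem
  gives \<open>v\<close>, and \<open>v0 \<ge> c u\<close> gives \<open>Re v \<ge> (c/2) u\<close>. The boundedness of \<open>S\<close> on \<open>E\<^sub>u\<close> follows from
  \<open>y = e\<^sup>-\<^sup>\<mu>\<^sup>0 T(1) y + \<integral>\<^sub>0\<^sup>1 e\<^sup>-\<^sup>\<mu>\<^sup>0\<^sup>s T(s) (\<mu>0 - A) y ds\<close>.\<close>

section \<open>The gauge of a principal ideal\<close>

lemma bounded_linear_real_part:
  "bounded_linear (real_part :: 'a::banach_lattice complexification \<Rightarrow> 'a)"
  by (rule bounded_linear_intro[of _ 1]) (simp_all add: norm_real_part_le)

lemma bounded_linear_imag_part:
  "bounded_linear (imag_part :: 'a::banach_lattice complexification \<Rightarrow> 'a)"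
  by (rule bounded_linear_intro[of _ 1]) (simp_all add: norm_imag_part_le)

lemma scaleC_scaleR_commute: "c *\<^sub>C (a *\<^sub>R z) = a *\<^sub>R (c *\<^sub>C z)"
  by (simp add: complexification_eq_iff algebra_simps)

lemma modulus_zero [simp]: "modulus 0 = 0"
  using modulus_scaleR[of 0 0] by simp

lemma modulus_minus [simp]: "modulus (- z) = modulus z"
  using modulus_scaleR[of "-1" z] by simp

lemma modulus_diff_le: "modulus (z - w) \<le> modulus z + modulus w"
  using modulus_triangle[of z "- w"] by simp

lemma modulus_eq_zero_iff: "modulus z = 0 \<longleftrightarrow> z = 0"
  by (metis modulus_zero norm_complexification_def norm_eq_zero)

lemma modulus_sum_le:
  "finite I \<Longrightarrow> modulus (\<Sum>i\<in>I. f i) \<le> (\<Sum>i\<in>I. modulus (f i))"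
proof (induction I rule: finite_induct)
  case (insert i I)
  then show ?case
    using modulus_triangle[of "f i" "\<Sum>i\<in>I. f i"] by (auto intro: order_trans add_left_mono)
qed simp

text \<open>The modulus is a supremum over the angle \<open>\<theta>\<close>, and each inequality
  for a single \<open>\<theta>\<close> passes to limits because the positive cone is closed. Balls
  of the gauge are therefore complete in the norm of \<open>E\<close>.\<close>

lemma closed_modulus_le: "closed {z. modulus z \<le> s}"
  unfolding closed_sequential_limits
proof clarify
  fix X z
  assume X: "\<forall>n. X n \<in> {z. modulus z \<le> s}" and lim: "X \<longlonglongrightarrow> z"
  have re: "(\<lambda>n. real_part (X n)) \<longlonglongrightarrow> real_part z"
    and im: "(\<lambda>n. imag_part (X n)) \<longlonglongrightarrow> imag_part z"
    using lim bounded_linear.tendsto[OF bounded_linear_real_part]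
      bounded_linear.tendsto[OF bounded_linear_imag_part] by blast+
  show "modulus z \<le> s"
  proof (rule modulus_least)
    fix \<theta>
    have "(\<lambda>n. cos \<theta> *\<^sub>R real_part (X n) + sin \<theta> *\<^sub>R imag_part (X n))
        \<longlonglongrightarrow> cos \<theta> *\<^sub>R real_part z + sin \<theta> *\<^sub>R imag_part z"
      by (intro tendsto_intros re im)
    then show "cos \<theta> *\<^sub>R real_part z + sin \<theta> *\<^sub>R imag_part z \<le> s"
      by (rule banach_lattice_LIMSEQ_le[OF _ tendsto_const])
        (use X modulus_upper order_trans in blast)
  qed
qed

lemma modulus_le_scaleR_mono:
  "modulus z \<le> a *\<^sub>R u \<Longrightarrow> a \<le> b \<Longrightarrow> 0 \<le> u \<Longrightarrow> modulus z \<le> b *\<^sub>R u"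
  by (meson order_trans scaleR_right_mono)

lemma norm_le_of_modulus_le:
  "modulus z \<le> a *\<^sub>R u \<Longrightarrow> norm z \<le> \<bar>a\<bar> * norm u"
  unfolding norm_complexification_def norm_scaleR[symmetric]
  by (rule norm_mono_nonneg) simp

lemma gauge_norm_le:
  "0 < a \<Longrightarrow> modulus z \<le> a *\<^sub>R u \<Longrightarrow> gauge_norm u z \<le> a"
  unfolding gauge_norm_def by (rule cInf_lower) (auto intro: bdd_belowI[of _ 0])

text \<open>The infimum in the gauge is attained: admissible constants approach it within
  \<open>1 / (n + 1)\<close>, and the closed cone admits the limit.\<close>

lemma modulus_le_gauge_norm:
  assumes "0 \<le> u" "z \<in> principal_ideal u"
  shows "modulus z \<le> gauge_norm u z *\<^sub>R u"
proof -
  let ?S = "{c. c > 0 \<and> modulus z \<le> c *\<^sub>R u}"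
  have ne: "?S \<noteq> {}" using assms(2) by (auto simp: principal_ideal_def)
  have "modulus z \<le> (gauge_norm u z + inverse (real (Suc n))) *\<^sub>R u" for n
  proof -
    have "Inf ?S < gauge_norm u z + inverse (real (Suc n))" by (simp add: gauge_norm_def)
    then obtain a where "a \<in> ?S" "a < gauge_norm u z + inverse (real (Suc n))"
      using cInf_lessD[OF ne] by blast
    then show ?thesis using modulus_le_scaleR_mono[OF _ _ assms(1)] by auto
  qed
  moreover have "(\<lambda>n. (gauge_norm u z + inverse (real (Suc n))) *\<^sub>R u)
      \<longlonglongrightarrow> (gauge_norm u z + 0) *\<^sub>R u"
    by (intro tendsto_intros LIMSEQ_inverse_real_of_nat)
  ultimately show ?thesis
    using banach_lattice_LIMSEQ_le[OF tendsto_const] by auto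
qed

text \<open>Homogeneity, by applying the bound to \<open>z / k\<close>. For \<open>k = 0\<close> no
  rescaling is possible, but then \<open>z = 0\<close>.\<close>

lemma gauge_bound_scale:
  assumes lin: "linear S" and bd: "\<And>z. modulus z \<le> u \<Longrightarrow> modulus (S z) \<le> K *\<^sub>R u"
    and "0 \<le> k" "modulus z \<le> k *\<^sub>R u"
  shows "modulus (S z) \<le> (K * k) *\<^sub>R u"
proof (cases "k = 0")
  case True
  then have "z = 0" using assms(4) modulus_nonneg[of z] by (simp add: modulus_eq_zero_iff)
  then show ?thesis using True lin by (simp add: linear_0)
next
  case False
  then have k: "0 < k" using assms by simp
  have "modulus (z /\<^sub>R k) = inverse k *\<^sub>R modulus z"
    using k by (simp add: modulus_scaleR)
  also have "\<dots> \<le> inverse k *\<^sub>R (k *\<^sub>R u)"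
    by (intro scaleR_left_mono assms(4)) (use k in simp)
  also have "\<dots> = u" using k by simp
  finally have "modulus (S (z /\<^sub>R k)) \<le> K *\<^sub>R u" by (rule bd)
  then have "k *\<^sub>R modulus (S (z /\<^sub>R k)) \<le> k *\<^sub>R (K *\<^sub>R u)"
    using k by (intro scaleR_left_mono) auto
  then show ?thesis using k lin by (simp add: linear_scale modulus_scaleR mult.commute)
qed

lemma op_norm_bound:
  assumes "op_norm N X M S \<le> ennreal K" "x \<in> X" "N x \<le> 1" "0 \<le> K"
  shows "M (S x) \<le> K"
proof -
  have "ennreal (M (S x)) \<le> op_norm N X M S"
    unfolding op_norm_def using assms by (intro SUP_upper) auto
  then have "ennreal (M (S x)) \<le> ennreal K" using assms by (meson order_trans)
  then show ?thesis using assms(4) by (simp add: ennreal_le_iff)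
qed

text \<open>This trades the extended-real operator norm for a pointwise order inequality, the form
  in which the semigroup estimates are used. No constant is lost since the gauge infimum is
  attained.\<close>

lemma modulus_le_of_op_norm:
  assumes u: "0 \<le> u" and lin: "linear S" and ran: "range S \<subseteq> principal_ideal u"
    and op: "op_norm norm UNIV (gauge_norm u) S \<le> ennreal K" and K: "0 \<le> K"
  shows "modulus (S x) \<le> (K * norm x) *\<^sub>R u"
proof (cases "x = 0")
  case False
  have "gauge_norm u (S (x /\<^sub>R norm x)) \<le> K"
    by (rule op_norm_bound[OF op]) (use False K in auto)
  then have "modulus (S (x /\<^sub>R norm x)) \<le> K *\<^sub>R u"
    using modulus_le_gauge_norm[OF u, of "S (x /\<^sub>R norm x)"] ran
      modulus_le_scaleR_mono[OF _ _ u] by blast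
  then have "norm x *\<^sub>R modulus (S (x /\<^sub>R norm x)) \<le> norm x *\<^sub>R (K *\<^sub>R u)"
    by (intro scaleR_left_mono) auto
  then show ?thesis using False lin by (simp add: linear_scale modulus_scaleR mult.commute)
qed (use lin in \<open>simp add: linear_0\<close>)

lemma modulus_le_of_op_norm_gauge:
  assumes u: "0 \<le> u" and lin: "linear S" and ran: "range S \<subseteq> principal_ideal u"
    and op: "op_norm (gauge_norm u) (principal_ideal u) (gauge_norm u) S \<le> ennreal K"
    and K: "0 \<le> K" and k: "0 \<le> k" "modulus x \<le> k *\<^sub>R u"
  shows "modulus (S x) \<le> (K * k) *\<^sub>R u"
proof (rule gauge_bound_scale[OF lin _ k])
  fix z assume "modulus z \<le> u"
  then have z: "modulus z \<le> 1 *\<^sub>R u" by simp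
  have "gauge_norm u (S z) \<le> K"
  proof (rule op_norm_bound[OF op])
    show "z \<in> principal_ideal u" using z zero_less_one unfolding principal_ideal_def by blast
    show "gauge_norm u z \<le> 1" by (rule gauge_norm_le[OF zero_less_one z])
  qed (rule K)
  then show "modulus (S z) \<le> K *\<^sub>R u"
    using modulus_le_gauge_norm[OF u, of "S z"] ran modulus_le_scaleR_mono[OF _ _ u] by blast
qed

text \<open>The unit ball of \<open>E\<^sub>u\<close> is closed in \<open>E\<close>, so the Baire category theorem applies to it
  with the topology of \<open>E\<close>; this replaces the closed graph theorem on \<open>E\<^sub>u\<close>.\<close>

lemma bounded_on_principal_ideal:
  fixes B :: "'a::banach_lattice complexification \<Rightarrow> 'a complexification"
  assumes u: "0 \<le> u" and B: "bounded_linear B"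
    and inv: "B ` principal_ideal u \<subseteq> principal_ideal u"
  obtains K where "0 \<le> K"
    "\<And>z k. 0 \<le> k \<Longrightarrow> modulus z \<le> k *\<^sub>R u \<Longrightarrow> modulus (B z) \<le> (K * k) *\<^sub>R u"
proof -
  interpret B: bounded_linear B by (rule B)
  define X where "X = {z :: 'a complexification. modulus z \<le> u}"
  define G where "G n = X \<inter> B -` {z. modulus z \<le> real n *\<^sub>R u}" for n
  have clX: "closed X" unfolding X_def by (rule closed_modulus_le)
  have clG: "closed (G n)" for n
    unfolding G_def using B
    by (intro closed_Int clX closed_vimage closed_modulus_le linear_continuous_on)
  have UG: "\<Union>(range G) = X"
  proof
    show "X \<subseteq> \<Union>(range G)"
    proof
      fix z assume z: "z \<in> X"
      then have "modulus z \<le> 1 *\<^sub>R u" by (simp add: X_def)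
      then have "z \<in> principal_ideal u" unfolding principal_ideal_def using zero_less_one by blast
      then obtain c where c: "modulus (B z) \<le> c *\<^sub>R u"
        using inv by (fastforce simp: principal_ideal_def)
      obtain n where "c \<le> real n" using real_arch_simple by blast
      then show "z \<in> \<Union>(range G)" using c z modulus_le_scaleR_mono[OF _ _ u] by (auto simp: G_def)
    qed
  qed (auto simp: G_def)
  \<comment> \<open>Invariance of \<open>E_u\<close> makes \<open>X\<close> the countable union of
    the closed sets \<open>G n\<close>, so one of them has interior points relative to the complete
    space \<open>X\<close>.\<close>
  have "\<exists>n. top_of_set X interior_of G n \<noteq> {}"
  proof (rule ccontr)
    assume "\<not> ?thesis"
    then have "top_of_set X interior_of \<Union>(range G) = {}"
      by (intro Baire_category_alt disjI1 completely_metrizable_space_closedin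
          completely_metrizable_space_euclidean)
        (use clX clG in \<open>auto simp: closedin_closed_eq G_def closed_subset intro!: closed_subset\<close>)
    moreover have "top_of_set X interior_of X = X"
      by (metis interior_of_topspace topspace_euclidean_subtopology)
    moreover have "0 \<in> X" using u by (simp add: X_def)
    ultimately show False using UG by auto
  qed
  then obtain n x0 where x0: "x0 \<in> top_of_set X interior_of G n" by blast
  then obtain W where "open W" "x0 \<in> W" "x0 \<in> X" and W: "W \<inter> X \<subseteq> G n"
    by (auto simp: interior_of_def openin_open)
  then obtain e where e: "0 < e" "ball x0 e \<subseteq> W" by (meson openE)
  \<comment> \<open>Moving from \<open>x0\<close> by the fraction \<open>r\<close> towards any point
    of \<open>X\<close> covers a distance of at most \<open>r * (2 * norm u) < e\<close>, hence
    stays inside \<open>W\<close>; \<open>r < 1\<close> makes this a convex combination.\<close>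
  define r where "r = e / (2 * norm u + e + 1)"
  have den: "0 < 2 * norm u + e + 1" using e norm_ge_zero[of u] by linarith
  have "0 < 1 + norm u * 2" using norm_ge_zero[of u] by linarith
  then have r: "0 < r" "r < 1" "r * (2 * norm u) < e"
    using e den \<open>0 < 1 + norm u * 2\<close>
    by (auto simp: r_def field_simps intro: add_pos_pos)
  have modx0: "modulus (B x0) \<le> real n *\<^sub>R u" and x0X: "modulus x0 \<le> u"
    using \<open>x0 \<in> W\<close> \<open>x0 \<in> X\<close> W by (auto simp: G_def X_def)
  have bd: "modulus (B y) \<le> (2 * real n / r) *\<^sub>R u" if y: "modulus y \<le> u" for y
  proof -
    \<comment> \<open>Convexity keeps \<open>w\<close> in \<open>X\<close>, so \<open>w\<close> lies
      in \<open>G n\<close>. Solving for \<open>B y\<close> in terms of \<open>B w\<close> and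
      \<open>B x0\<close>, both bounded by \<open>n u\<close>, costs the factor
      \<open>2 / r\<close>.\<close>
    define w where "w = (1 - r) *\<^sub>R x0 + r *\<^sub>R y"
    have "modulus w \<le> modulus ((1 - r) *\<^sub>R x0) + modulus (r *\<^sub>R y)"
      unfolding w_def by (rule modulus_triangle)
    also have "\<dots> \<le> (1 - r) *\<^sub>R u + r *\<^sub>R u"
      unfolding modulus_scaleR using r x0X y by (intro add_mono) (auto intro!: scaleR_left_mono)
    finally have wX: "w \<in> X" by (simp add: X_def algebra_simps)
    have "w - x0 = r *\<^sub>R (y - x0)" by (simp add: w_def algebra_simps)
    then have "norm (w - x0) \<le> r * (norm y + norm x0)"
      using r norm_triangle_ineq4[of y x0] by simp
    also have "\<dots> \<le> r * (2 * norm u)"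
      using r norm_le_of_modulus_le[of y 1 u] norm_le_of_modulus_le[of x0 1 u] y x0X
      by (intro mult_left_mono) auto
    finally have "w \<in> W" using r e by (auto simp: dist_norm norm_minus_commute)
    then have "modulus (B w) \<le> real n *\<^sub>R u" using W wX by (auto simp: G_def)
    have "r *\<^sub>R B y = B w - (1 - r) *\<^sub>R B x0"
      by (simp add: w_def B.add B.scaleR)
    then have "B y = inverse r *\<^sub>R (B w - (1 - r) *\<^sub>R B x0)"
      using r by (metis less_irrefl scaleR_left_commute scaleR_scaleR scaleR_one left_inverse)
    then have "modulus (B y) = inverse r *\<^sub>R modulus (B w - (1 - r) *\<^sub>R B x0)"
      using r by (simp add: modulus_scaleR)
    also have "\<dots> \<le> inverse r *\<^sub>R (real n *\<^sub>R u + real n *\<^sub>R u)"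
    proof (intro scaleR_left_mono)
      have "modulus (B w - (1 - r) *\<^sub>R B x0) \<le> modulus (B w) + modulus ((1 - r) *\<^sub>R B x0)"
        by (rule modulus_diff_le)
      also have "modulus ((1 - r) *\<^sub>R B x0) \<le> 1 *\<^sub>R modulus (B x0)"
        unfolding modulus_scaleR using r by (intro scaleR_right_mono) auto
      also have "modulus (B w) + 1 *\<^sub>R modulus (B x0) \<le> real n *\<^sub>R u + real n *\<^sub>R u"
        using modx0 \<open>modulus (B w) \<le> real n *\<^sub>R u\<close> by (intro add_mono) auto
      finally show "modulus (B w - (1 - r) *\<^sub>R B x0) \<le> real n *\<^sub>R u + real n *\<^sub>R u" by simp
    qed (use r in simp)
    also have "\<dots> = (2 * real n / r) *\<^sub>R u"
      by (simp add: scaleR_add_left[symmetric] field_simps)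
    finally show ?thesis .
  qed
  show ?thesis
    by (rule that[of "2 * real n / r"])
      (use r gauge_bound_scale[OF B.linear_axioms bd] in auto)
qed

section \<open>Gauge estimates for solutions of the resolvent equation\<close>

text \<open>The vector \<open>y\<close> differs from \<open>exp (- \<mu>) *\<^sub>R T 1 y\<close> by the integral of
  \<open>exp (- \<mu> * s) *\<^sub>R T s f\<close> over \<open>[0, 1]\<close>. Telescoping on \<open>[\<epsilon>, 1]\<close> bounds this difference without
  integration: ultracontractivity turns the norm error of the difference quotients
  into a gauge error that is uniform on \<open>[\<epsilon>, 1]\<close>, and \<open>\<epsilon>\<close> tends to \<open>0\<close> in the end.\<close>

lemma modulus_le_of_generator:
  fixes T :: "real \<Rightarrow> 'a::banach_lattice complexification \<Rightarrow> 'a complexification"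
  assumes sg: "C0_semigroup T" and gen: "generates D A T" and y: "y \<in> D" and u: "0 \<le> u"
    and f: "f = \<mu> *\<^sub>R y - A y"
    and ultra: "\<And>t x. 0 < t \<Longrightarrow> t \<le> 1 \<Longrightarrow> modulus (T t x) \<le> (C * t powr (- \<alpha>) * norm x) *\<^sub>R u"
    and ideal: "\<And>t x k. 0 < t \<Longrightarrow> t \<le> 1 \<Longrightarrow> 0 \<le> k \<Longrightarrow> modulus x \<le> k *\<^sub>R u \<Longrightarrow>
      modulus (T t x) \<le> (C' * k) *\<^sub>R u"
    and C: "0 \<le> C" "0 \<le> C'" "0 \<le> \<alpha>" and k: "0 \<le> k" "modulus f \<le> k *\<^sub>R u"
  shows "modulus y \<le> (exp \<bar>\<mu>\<bar> * (C * norm y + C' * k)) *\<^sub>R u"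
proof -
  define M where "M = exp \<bar>\<mu>\<bar>"
  have M0: "0 \<le> M" by (simp add: M_def)
  \<comment> \<open>The rescaled semigroup, whose generator is \<open>A - \<mu>\<close>.\<close>
  define V where "V s x = exp (- (\<mu> * s)) *\<^sub>R T s x" for s x
  have linT: "linear (T t)" if "0 \<le> t" for t
    using sg that bounded_linear.linear unfolding C0_semigroup_def bounded_clinear_def by blast
  have linV: "linear (V t)" if "0 \<le> t" for t
    unfolding V_def using linT[OF that] by (intro linear_compose_scale_right)
  have Vadd: "V (s + t) x = V s (V t x)" if "0 \<le> s" "0 \<le> t" for s t x
  proof -
    have "T (s + t) x = T s (T t x)" using sg that by (simp add: C0_semigroup_def)
    then show ?thesis
      using linT[OF that(1)] by (simp add: V_def linear_scale exp_add[symmetric] algebra_simps)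
  qed
  have expM: "exp (- (\<mu> * s)) \<le> M" if "0 \<le> s" "s \<le> 1" for s
  proof -
    have "- (\<mu> * s) \<le> \<bar>\<mu>\<bar> * s" using that mult_right_mono[of "- \<mu>" "\<bar>\<mu>\<bar>" s] by simp
    also have "\<dots> \<le> \<bar>\<mu>\<bar>" using that by (simp add: mult_left_le)
    finally show ?thesis by (simp add: M_def)
  qed
  have V_bound: "modulus (V s x) \<le> (M * b) *\<^sub>R u"
    if "0 < s" "s \<le> 1" "modulus (T s x) \<le> b *\<^sub>R u" "0 \<le> b" for s x b
  proof -
    have "modulus (V s x) = exp (- (\<mu> * s)) *\<^sub>R modulus (T s x)" by (simp add: V_def modulus_scaleR)
    also have "\<dots> \<le> M *\<^sub>R (b *\<^sub>R u)"
      using that u expM[of s] M0 by (intro scaleR_mono) (auto intro: scaleR_nonneg_nonneg)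
    finally show ?thesis by simp
  qed
  define d where "d h = (y - V h y) /\<^sub>R h" for h
  have d: "(d \<longlongrightarrow> f) (at_right 0)"
  proof -
    have "((\<lambda>h. (T h y - y) /\<^sub>R h) \<longlongrightarrow> A y) (at_right 0)"
      using gen y by (simp add: generates_def)
    moreover have "((\<lambda>h. exp (- (\<mu> * h))) \<longlongrightarrow> exp (- (\<mu> * 0))) (at_right 0)"
      by (intro tendsto_intros)
    moreover have "((\<lambda>h. (exp (- (\<mu> * h)) - 1) / h) \<longlongrightarrow> - \<mu>) (at_right 0)"
    proof -
      have "((\<lambda>h. exp (- (\<mu> * h))) has_field_derivative - \<mu>) (at 0)"
        by (auto intro!: derivative_eq_intros)
      then have "((\<lambda>h. (exp (- (\<mu> * h)) - 1) / h) \<longlongrightarrow> - \<mu>) (at 0)"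
        by (simp add: DERIV_def)
      then show ?thesis by (rule tendsto_within_subset) simp
    qed
    \<comment> \<open>Product rule at \<open>h = 0\<close> for the exponential factor and the orbit
      of \<open>y\<close>.\<close>
    ultimately have "((\<lambda>h. - (exp (- (\<mu> * h)) *\<^sub>R ((T h y - y) /\<^sub>R h)
        + ((exp (- (\<mu> * h)) - 1) / h) *\<^sub>R y)) \<longlongrightarrow> - (exp (- (\<mu> * 0)) *\<^sub>R A y + (- \<mu>) *\<^sub>R y))
        (at_right 0)"
      by (intro tendsto_intros)
    moreover have "- (exp (- (\<mu> * h)) *\<^sub>R ((T h y - y) /\<^sub>R h)
        + ((exp (- (\<mu> * h)) - 1) / h) *\<^sub>R y) = d h" for h
      by (simp add: d_def V_def algebra_simps divide_inverse)
    ultimately show ?thesis by (simp add: f)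
  qed
  have tele: "V \<epsilon> y - V (\<epsilon> + real n * h) y = h *\<^sub>R (\<Sum>j<n. V (\<epsilon> + real j * h) (d h))"
    if "0 < \<epsilon>" "0 < h" for \<epsilon> h n
  proof -
    have "V (\<epsilon> + real j * h) y - V (\<epsilon> + real (Suc j) * h) y = h *\<^sub>R V (\<epsilon> + real j * h) (d h)" for j
    proof -
      have p: "0 \<le> \<epsilon> + real j * h" using that by simp
      have "V (\<epsilon> + real (Suc j) * h) y = V (\<epsilon> + real j * h) (V h y)"
        using Vadd[OF p, of h y] that by (simp add: algebra_simps)
      then have "V (\<epsilon> + real j * h) y - V (\<epsilon> + real (Suc j) * h) y = V (\<epsilon> + real j * h) (y - V h y)"
        using linear_diff[OF linV[OF p]] by simp
      also have "y - V h y = h *\<^sub>R d h" using that by (simp add: d_def)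
      finally show ?thesis using linear_scale[OF linV[OF p]] by simp
    qed
    then have "h *\<^sub>R (\<Sum>j<n. V (\<epsilon> + real j * h) (d h))
        = (\<Sum>j<n. V (\<epsilon> + real j * h) y - V (\<epsilon> + real (Suc j) * h) y)"
      by (simp add: scaleR_sum_right)
    also have "\<dots> = V (\<epsilon> + real 0 * h) y - V (\<epsilon> + real n * h) y"
      by (rule sum_lessThan_telescope')
    finally show ?thesis by simp
  qed
  have eps: "modulus (V \<epsilon> y - V 1 y) \<le> (M * C' * k) *\<^sub>R u" if \<epsilon>: "0 < \<epsilon>" "\<epsilon> < 1" for \<epsilon>
  proof -
    \<comment> \<open>\<open>Suc n\<close> steps of this length lead exactly from
      \<open>\<epsilon>\<close> to \<open>1\<close>.\<close>
    define h where "h n = (1 - \<epsilon>) * inverse (real (Suc n))" for n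
    have h: "0 < h n" "real (Suc n) * h n = 1 - \<epsilon>" for n using \<epsilon> by (simp_all add: h_def)
    \<comment> \<open>The power decreases in time, so its value at \<open>\<epsilon>\<close> serves
      on all of \<open>[\<epsilon>, 1]\<close>. However large \<open>K\<close> is, for fixed
      \<open>\<epsilon>\<close> it multiplies an error that tends to \<open>0\<close>, so it is
      absent from the limit of \<open>b n\<close>.\<close>
    define K where "K = C * \<epsilon> powr (- \<alpha>)"
    define b where "b n = M * (C' * k) + M * (K * norm (d (h n) - f))" for n
    have bd: "modulus (V s (d (h n))) \<le> b n *\<^sub>R u" if s: "\<epsilon> \<le> s" "s \<le> 1" for s n
    proof -
      have s0: "0 < s" using s \<epsilon> by simp
      have "V s (d (h n)) = V s f + V s (d (h n) - f)"
        using linear_add[OF linV, of s f "d (h n) - f"] s0 by simp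
      then have "modulus (V s (d (h n))) \<le> modulus (V s f) + modulus (V s (d (h n) - f))"
        by (simp add: modulus_triangle)
      also have "\<dots> \<le> (M * (C' * k)) *\<^sub>R u + (M * (K * norm (d (h n) - f))) *\<^sub>R u"
      proof (intro add_mono V_bound s0 s)
        show "modulus (T s f) \<le> (C' * k) *\<^sub>R u" by (rule ideal[OF s0 s(2) k])
        have "C * s powr (- \<alpha>) * norm (d (h n) - f) \<le> K * norm (d (h n) - f)"
          unfolding K_def using s \<epsilon> C
          by (intro mult_right_mono mult_left_mono powr_mono2') auto
        then show "modulus (T s (d (h n) - f)) \<le> (K * norm (d (h n) - f)) *\<^sub>R u"
          using ultra[OF s0 s(2)] modulus_le_scaleR_mono[OF _ _ u] by blast
      qed (use C k in \<open>auto simp: K_def\<close>)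
      finally show ?thesis by (simp add: b_def scaleR_add_left)
    qed
    have b0: "0 \<le> b n" for n using C k M0 by (simp add: b_def K_def)
    have "modulus (V \<epsilon> y - V 1 y) \<le> b n *\<^sub>R u" for n
    proof -
      have "V \<epsilon> y - V 1 y = h n *\<^sub>R (\<Sum>j<Suc n. V (\<epsilon> + real j * h n) (d (h n)))"
        using tele[OF \<epsilon>(1) h(1)[of n], of "Suc n"] h(2)[of n] by simp
      then have "modulus (V \<epsilon> y - V 1 y)
          = h n *\<^sub>R modulus (\<Sum>j<Suc n. V (\<epsilon> + real j * h n) (d (h n)))"
        using h(1)[of n] by (simp only: modulus_scaleR abs_of_pos)
      also have "\<dots> \<le> h n *\<^sub>R (\<Sum>j<Suc n. modulus (V (\<epsilon> + real j * h n) (d (h n))))"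
        using h(1)[of n] by (intro scaleR_left_mono modulus_sum_le) auto
      also have "\<dots> \<le> h n *\<^sub>R (\<Sum>j<Suc n. b n *\<^sub>R u)"
      proof (intro scaleR_left_mono sum_mono bd)
        fix j assume "j \<in> {..<Suc n}"
        then have "real j * h n \<le> real (Suc n) * h n"
          using h(1)[of n] by (intro mult_right_mono) auto
        then show "\<epsilon> + real j * h n \<le> 1" using h(2)[of n] by simp
      qed (use h(1)[of n] in auto)
      also have "\<dots> = ((1 - \<epsilon>) * b n) *\<^sub>R u"
        using h(2)[of n, symmetric]
        by (simp add: sum_constant_scaleR mult_ac del: sum.lessThan_Suc of_nat_Suc)
      also have "\<dots> \<le> b n *\<^sub>R u"
        using \<epsilon> b0[of n] u by (intro scaleR_right_mono) (auto simp: mult_left_le_one_le)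
      finally show ?thesis .
    qed
    moreover have "(\<lambda>n. b n *\<^sub>R u) \<longlonglongrightarrow> (M * (C' * k) + M * (K * 0)) *\<^sub>R u"
    proof -
      have "h \<longlonglongrightarrow> (1 - \<epsilon>) * 0"
        unfolding h_def by (intro tendsto_intros LIMSEQ_inverse_real_of_nat)
      then have "filterlim h (at_right 0) sequentially"
        using h(1) by (intro tendsto_imp_filterlim_at_right) simp_all
      then have "(\<lambda>n. d (h n)) \<longlonglongrightarrow> f" by (rule filterlim_compose[OF d])
      then have "(\<lambda>n. norm (d (h n) - f)) \<longlonglongrightarrow> 0" by (simp add: LIM_zero tendsto_norm_zero)
      then show ?thesis unfolding b_def by (intro tendsto_intros)
    qed
    ultimately have "modulus (V \<epsilon> y - V 1 y) \<le> (M * (C' * k) + M * (K * 0)) *\<^sub>R u"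
      by (blast intro: banach_lattice_LIMSEQ_le[OF tendsto_const])
    then show ?thesis by (simp add: mult.assoc)
  qed
  have "modulus (y - V 1 y) \<le> (M * C' * k) *\<^sub>R u"
  proof -
    have "((\<lambda>t. V t y) \<longlongrightarrow> exp (- (\<mu> * 0)) *\<^sub>R y) (at_right 0)"
      unfolding V_def using sg by (intro tendsto_intros) (simp add: C0_semigroup_def)
    then have "((\<lambda>t. V t y - V 1 y) \<longlongrightarrow> y - V 1 y) (at_right 0)"
      by (intro tendsto_intros) simp
    moreover have "eventually (\<lambda>t. V t y - V 1 y \<in> {z. modulus z \<le> (M * C' * k) *\<^sub>R u}) (at_right 0)"
      using eps unfolding eventually_at_right_field by (intro exI[of _ 1]) auto
    ultimately have "y - V 1 y \<in> {z. modulus z \<le> (M * C' * k) *\<^sub>R u}"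
      by (intro Lim_in_closed_set[OF closed_modulus_le _ trivial_limit_at_right_real])
    then show ?thesis by simp
  qed
  \<comment> \<open>At time \<open>1\<close> the factor \<open>t powr (- \<alpha>)\<close> equals
    \<open>1\<close>.\<close>
  moreover have "modulus (V 1 y) \<le> (M * (C * norm y)) *\<^sub>R u"
    using ultra[of 1 y] C by (intro V_bound) auto
  ultimately have "modulus (y - V 1 y) + modulus (V 1 y)
      \<le> (M * C' * k) *\<^sub>R u + (M * (C * norm y)) *\<^sub>R u"
    by (rule add_mono)
  then have "modulus y \<le> (M * C' * k) *\<^sub>R u + (M * (C * norm y)) *\<^sub>R u"
    using modulus_triangle[of "y - V 1 y" "V 1 y"] by simp
  then have "modulus y \<le> (M * C' * k + M * (C * norm y)) *\<^sub>R u"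
    by (simp only: scaleR_add_left)
  then show ?thesis by (simp add: M_def distrib_left mult.assoc add.commute)
qed

section \<open>Simple poles of the resolvent\<close>

text \<open>The spectral projection \<open>P\<close> belonging to \<open>l\<close> is \<open>P x = \<phi> x *\<^sub>C v0\<close>, and \<open>S\<close> is the reduced
  resolvent, the inverse of \<open>l - A\<close> on the kernel of \<open>P\<close> extended by \<open>0\<close>.\<close>

locale simple_pole =
  fixes D :: "'a::banach_lattice complexification set"
    and A S :: "'a complexification \<Rightarrow> 'a complexification"
    and l :: complex and v0 :: "'a complexification" and \<phi> :: "'a complexification \<Rightarrow> complex"
  assumes D_add: "x \<in> D \<Longrightarrow> y \<in> D \<Longrightarrow> x + y \<in> D"
    and D_scale: "x \<in> D \<Longrightarrow> a *\<^sub>C x \<in> D"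
    and A_add: "x \<in> D \<Longrightarrow> y \<in> D \<Longrightarrow> A (x + y) = A x + A y"
    and A_scale: "x \<in> D \<Longrightarrow> A (a *\<^sub>C x) = a *\<^sub>C A x"
    and v0: "eigenvector D A l v0"
    and \<phi>_add: "\<phi> (x + y) = \<phi> x + \<phi> y"
    and \<phi>_scale: "\<phi> (a *\<^sub>C x) = a * \<phi> x"
    and \<phi>_bounded: "\<exists>K\<ge>0. \<forall>x. cmod (\<phi> x) \<le> K * norm x"
    and S: "bounded_clinear S"
    and S_range: "S x \<in> D"
    and S_right: "l *\<^sub>C S x - A (S x) = x - \<phi> x *\<^sub>C v0"
    and S_left: "x \<in> D \<Longrightarrow> S (l *\<^sub>C x - A x) = x - \<phi> x *\<^sub>C v0"
    and \<phi>_S: "\<phi> (S x) = 0"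

text \<open>\<open>D\<close> is exactly the set of vectors whose difference quotients converge, so
  linearity of \<open>T h\<close> for \<open>h > 0\<close> passes to the limit.\<close>

lemma generator_linear:
  fixes T :: "real \<Rightarrow> 'a::banach_lattice complexification \<Rightarrow> 'a complexification"
  assumes sg: "C0_semigroup T" and gen: "generates D A T"
  shows "x \<in> D \<Longrightarrow> y \<in> D \<Longrightarrow> x + y \<in> D \<and> A (x + y) = A x + A y"
    and "x \<in> D \<Longrightarrow> a *\<^sub>C x \<in> D \<and> A (a *\<^sub>C x) = a *\<^sub>C A x"
proof -
  let ?q = "\<lambda>x h. (T h x - x) /\<^sub>R h"
  have lim: "(?q x \<longlongrightarrow> A x) (at_right 0)" if "x \<in> D" for x
    using gen that by (simp add: generates_def)
  have mem: "x \<in> D \<and> A x = y" if "(?q x \<longlongrightarrow> y) (at_right 0)" for x y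
  proof -
    have "x \<in> D" using gen that by (auto simp: generates_def)
    with lim[OF this] that show ?thesis
      using tendsto_unique trivial_limit_at_right_real by blast
  qed
  have lin: "T h (x + y) = T h x + T h y" "T h (a *\<^sub>C x) = a *\<^sub>C T h x" if "0 < h" for h x y a
  proof -
    have "bounded_clinear (T h)" using sg that by (simp add: C0_semigroup_def)
    then show "T h (x + y) = T h x + T h y" "T h (a *\<^sub>C x) = a *\<^sub>C T h x"
      by (auto simp: bounded_clinear_def linear_add bounded_linear.linear)
  qed
  have pos: "eventually (\<lambda>h. 0 < h) (at_right (0 :: real))"
    by (simp add: eventually_at_right_less)
  show "x \<in> D \<Longrightarrow> y \<in> D \<Longrightarrow> x + y \<in> D \<and> A (x + y) = A x + A y"
  proof (rule mem)
    assume "x \<in> D" "y \<in> D"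
    then have "((\<lambda>h. ?q x h + ?q y h) \<longlongrightarrow> A x + A y) (at_right 0)"
      by (intro tendsto_add lim)
    then show "(?q (x + y) \<longlongrightarrow> A x + A y) (at_right 0)"
      by (rule Lim_transform_eventually)
        (use pos in eventually_elim, simp add: lin algebra_simps)
  qed
  show "x \<in> D \<Longrightarrow> a *\<^sub>C x \<in> D \<and> A (a *\<^sub>C x) = a *\<^sub>C A x"
  proof (rule mem)
    assume "x \<in> D"
    then have "((\<lambda>h. a *\<^sub>C ?q x h) \<longlongrightarrow> a *\<^sub>C A x) (at_right 0)"
      by (intro bounded_linear.tendsto[OF bounded_linear_scaleC] lim)
    then show "(?q (a *\<^sub>C x) \<longlongrightarrow> a *\<^sub>C A x) (at_right 0)"
      by (rule Lim_transform_eventually)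
        (use pos in eventually_elim,
          simp add: lin scaleC_scaleR_commute complexification.scale_right_diff_distrib)
  qed
qed

lemma
  assumes z: "z \<in> resolvent_set D A"
  shows resolvent_mem: "resolvent D A z x \<in> D"
    and resolvent_right: "z *\<^sub>C resolvent D A z x - A (resolvent D A z x) = x"
    and resolvent_left: "y \<in> D \<Longrightarrow> resolvent D A z (z *\<^sub>C y - A y) = y"
    and resolvent_clinear: "bounded_clinear (resolvent D A z)"
proof -
  have bij: "bij_betw (\<lambda>x. z *\<^sub>C x - A x) D UNIV"
    using z by (simp add: resolvent_set_def)
  show "resolvent D A z x \<in> D"
    unfolding resolvent_def using bij by (auto intro: the_inv_into_into simp: bij_betw_def)
  show "z *\<^sub>C resolvent D A z x - A (resolvent D A z x) = x"
    unfolding resolvent_def using f_the_inv_into_f_bij_betw[OF bij] by simp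
  show "y \<in> D \<Longrightarrow> resolvent D A z (z *\<^sub>C y - A y) = y"
    unfolding resolvent_def using bij by (auto intro: the_inv_into_f_eq simp: bij_betw_def)
  show "bounded_clinear (resolvent D A z)" using z by (simp add: resolvent_set_def)
qed

text \<open>The terms at \<open>t = r\<close> are bounded, so for \<open>t \<le> r / 2\<close> a
  geometric series dominates the tail, which is \<open>O(t)\<close>. Real \<open>t > 0\<close>
  suffice for reading off Laurent coefficients along a half-line.\<close>

lemma power_series_tendsto_0:
  fixes a :: "nat \<Rightarrow> 'b::banach"
  assumes "0 < r" and sums: "\<And>t. 0 < t \<Longrightarrow> t \<le> r \<Longrightarrow> (\<lambda>k. t ^ k *\<^sub>R a k) sums G t"
  shows "(G \<longlongrightarrow> a 0) (at_right 0)"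
proof -
  have "Bseq (\<lambda>k. r ^ k *\<^sub>R a k)"
    using sums[of r] \<open>0 < r\<close> summable_LIMSEQ_zero convergentI
    by (blast intro: convergent_imp_Bseq sums_summable)
  then obtain M where M: "0 < M" "\<And>k. norm (r ^ k *\<^sub>R a k) \<le> M" by (auto simp: Bseq_def)
  have bound: "norm (G t - a 0) \<le> 2 * M / r * t" if t: "0 < t" "t \<le> r / 2" for t
  proof -
    have q: "0 \<le> t / r" "t / r < 1" "t / r \<le> 1 / 2" using t \<open>0 < r\<close> by (auto simp: field_simps)
    have *: "(\<lambda>k. t ^ Suc k *\<^sub>R a (Suc k)) sums (G t - a 0)"
      using sums_Suc_iff[of "\<lambda>k. t ^ k *\<^sub>R a k" "G t - a 0"] sums[of t] t \<open>0 < r\<close> by simp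
    have geo: "(\<lambda>k. M * (t / r) * (t / r) ^ k) sums (M * (t / r) * (1 / (1 - t / r)))"
      using q by (intro sums_mult geometric_sums) (simp only: real_norm_def abs_of_nonneg)
    have "norm (t ^ Suc k *\<^sub>R a (Suc k)) \<le> M * (t / r) * (t / r) ^ k" for k
    proof -
      have "t ^ Suc k *\<^sub>R a (Suc k) = (t / r) ^ Suc k *\<^sub>R (r ^ Suc k *\<^sub>R a (Suc k))"
        using \<open>0 < r\<close> by (simp add: power_divide)
      then have "norm (t ^ Suc k *\<^sub>R a (Suc k)) = (t / r) ^ Suc k * norm (r ^ Suc k *\<^sub>R a (Suc k))"
        using q by (simp only: norm_scaleR abs_of_nonneg zero_le_power)
      also have "\<dots> \<le> (t / r) ^ Suc k * M" by (intro mult_left_mono M zero_le_power q(1))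
      finally show ?thesis by (simp add: mult_ac)
    qed
    then have "norm (G t - a 0) \<le> M * (t / r) * (1 / (1 - t / r))"
      using norm_suminf_le[OF _ sums_summable[OF geo], of "\<lambda>k. t ^ Suc k *\<^sub>R a (Suc k)"]
        sums_unique[OF *] sums_unique[OF geo] by simp
    also have "\<dots> \<le> M * (t / r) * 2"
    proof (intro mult_left_mono mult_nonneg_nonneg less_imp_le[OF M(1)] q(1))
      have "1 / (1 - t / r) \<le> 1 / (1 / 2)" by (rule frac_le) (use q in linarith)+
      then show "1 / (1 - t / r) \<le> 2" by simp
    qed
    finally show ?thesis by (simp add: mult_ac)
  qed
  have "((\<lambda>t. 2 * M / r * t) \<longlongrightarrow> 2 * M / r * 0) (at_right 0)" by (intro tendsto_intros)
  then have "((\<lambda>t. 2 * M / r * t) \<longlongrightarrow> 0) (at_right 0)" by simp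
  moreover have "eventually (\<lambda>t. norm (G t - a 0) \<le> 2 * M / r * t) (at_right 0)"
    unfolding eventually_at_right_field using bound \<open>0 < r\<close> by (intro exI[of _ "r / 2"]) auto
  ultimately have "((\<lambda>t. G t - a 0) \<longlongrightarrow> 0) (at_right 0)"
    by (rule Lim_null_comparison[rotated])
  then show ?thesis by (rule LIM_zero_cancel)
qed

text \<open>The preceding limit for the series shifted by one index.\<close>

lemma power_series_tendsto_1:
  fixes a :: "nat \<Rightarrow> 'b::banach"
  assumes "0 < r" and sums: "\<And>t. 0 < t \<Longrightarrow> t \<le> r \<Longrightarrow> (\<lambda>k. t ^ k *\<^sub>R a k) sums G t"
  shows "((\<lambda>t. (G t - a 0) /\<^sub>R t) \<longlongrightarrow> a 1) (at_right 0)"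
proof -
  have "(\<lambda>k. t ^ k *\<^sub>R a (Suc k)) sums ((G t - a 0) /\<^sub>R t)" if "0 < t" "t \<le> r" for t
  proof -
    have "(\<lambda>k. t ^ Suc k *\<^sub>R a (Suc k)) sums (G t - a 0)"
      using sums_Suc_iff[of "\<lambda>k. t ^ k *\<^sub>R a k" "G t - a 0"] sums[OF that] by simp
    then have "(\<lambda>k. inverse t *\<^sub>R (t ^ Suc k *\<^sub>R a (Suc k))) sums ((G t - a 0) /\<^sub>R t)"
      by (rule sums_scaleR_right)
    then show ?thesis using that by (simp add: mult.assoc[symmetric])
  qed
  then show ?thesis using power_series_tendsto_0[OF \<open>0 < r\<close>, of "\<lambda>k. a (Suc k)"] by simp
qed

text \<open>The generalised eigenspace has a basis of one vector, and the nonzero eigenvector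
  \<open>v\<close> is a multiple of it.\<close>

lemma simple_eigenvalue_span:
  assumes "algebraically_simple_eigenvalue D A l" "eigenvector D A l v"
    and "x \<in> generalised_eigenspace D A l"
  shows "\<exists>k. x = k *\<^sub>C v"
proof -
  let ?V = "generalised_eigenspace D A l"
  have "v \<in> ?V"
    unfolding generalised_eigenspace_def using assms(2)
    by (intro UN_I[of "Suc 0"]) (auto simp: eigenvector_def)
  obtain b where "b \<subseteq> ?V" "complexification.independent b" "?V \<subseteq> complexification.span b"
    "card b = complexification.dim ?V"
    by (rule complexification.basis_exists)
  moreover have "complexification.dim ?V = 1"
    using assms(1) by (simp add: algebraically_simple_eigenvalue_def)
  ultimately obtain e where e: "?V \<subseteq> complexification.span {e}" by (metis card_1_singletonE)
  then have "v \<in> complexification.span {e}" "x \<in> complexification.span {e}"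
    using \<open>v \<in> ?V\<close> assms(3) by auto
  then obtain p q where p: "v = p *\<^sub>C e" and q: "x = q *\<^sub>C e"
    by (auto simp: complexification.span_singleton)
  have "p \<noteq> 0" using p assms(2) by (auto simp: eigenvector_def)
  then have "x = (q / p) *\<^sub>C v" by (simp add: p q)
  then show ?thesis by blast
qed

text \<open>The first two Laurent coefficients are limits of expressions in the resolvent at
  \<open>l + t\<close> as \<open>t\<close> decreases to \<open>0\<close>. The resolvent identities
  survive these limits because \<open>A\<close> is closed, and algebraic simplicity leaves only a
  pole of order one with a rank-one leading coefficient.\<close>

lemma simple_pole_exists:
  fixes D :: "'a::banach_lattice complexification set"
  assumes D_add: "\<And>x y. x \<in> D \<Longrightarrow> y \<in> D \<Longrightarrow> x + y \<in> D \<and> A (x + y) = A x + A y"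
    and D_scale: "\<And>x a. x \<in> D \<Longrightarrow> a *\<^sub>C x \<in> D \<and> A (a *\<^sub>C x) = a *\<^sub>C A x"
    and pole: "resolvent_has_pole D A l"
    and simple: "algebraically_simple_eigenvalue D A l" and v0: "eigenvector D A l v0"
  obtains \<phi> S where "simple_pole D A S l v0 \<phi>"
proof -

  \<comment> \<open>Linearity of \<open>l - A\<close> on its domain\<close>
  define L where "L x = l *\<^sub>C x - A x" for x
  have D_scaleR: "a *\<^sub>R x \<in> D \<and> A (a *\<^sub>R x) = a *\<^sub>R A x" if "x \<in> D" for a x
    using D_scale[OF that, of "complex_of_real a"] by (simp add: scaleC_of_real)
  have D_diff: "x - y \<in> D \<and> A (x - y) = A x - A y" if "x \<in> D" "y \<in> D" for x y
    using D_add[of x "(-1) *\<^sub>R y"] D_scaleR[of y "-1"] that by simp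
  have L_diff: "L (x - y) = L x - L y" if "x \<in> D" "y \<in> D" for x y
    using D_diff[OF that] by (simp add: L_def complexification.scale_right_diff_distrib)
  have L_scaleR: "L (a *\<^sub>R x) = a *\<^sub>R L x" if "x \<in> D" for a x
    using D_scaleR[OF that, of a] by (simp add: L_def scaleC_scaleR_commute scaleR_diff_right)
  have L_scale: "L (a *\<^sub>C x) = a *\<^sub>C L x" if "x \<in> D" for a x
    using D_scale[OF that, of a]
    by (simp add: L_def complexification.scale_right_diff_distrib mult.commute)
  have v0D: "v0 \<in> D" "v0 \<noteq> 0" "L v0 = 0" using v0 by (auto simp: eigenvector_def L_def)

  \<comment> \<open>The Laurent expansion along \<open>l + t\<close> with real
    \<open>t > 0\<close>\<close>
  define R where "R t = resolvent D A (l + complex_of_real t)" for t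
  obtain m U where m: "1 \<le> m" and U0: "U 0 \<noteq> 0"
    and ev: "\<forall>\<^sub>F z in at l. z \<in> resolvent_set D A \<and>
      (\<lambda>k. blinfun_scaleC ((z - l) powi (int k - int m)) (U k)) sums Blinfun (resolvent D A z)"
    using pole unfolding resolvent_has_pole_def has_pole_def eventually_conj_iff by blast
  obtain e where e: "0 < e" and near: "\<And>z. z \<noteq> l \<Longrightarrow> dist z l < e \<Longrightarrow> z \<in> resolvent_set D A \<and>
      (\<lambda>k. blinfun_scaleC ((z - l) powi (int k - int m)) (U k)) sums Blinfun (resolvent D A z)"
    using ev unfolding eventually_at by blast
  \<comment> \<open>Halving makes the expansion valid at the end point \<open>t = r\<close> too, as
    the limit lemmas for power series require.\<close>
  define r where "r = e / 2"
  have r: "0 < r" "r < e" using e by (auto simp: r_def)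
  have res: "l + complex_of_real t \<in> resolvent_set D A" if "0 < t" "t \<le> r" for t
    using near[of "l + complex_of_real t"] that r by (simp add: dist_norm)
  \<comment> \<open>Multiplication by \<open>t ^ m\<close> turns the Laurent series into a power
    series with the same coefficients.\<close>
  have ser: "(\<lambda>k. t ^ k *\<^sub>R U k x) sums (t ^ m *\<^sub>R R t x)" if t: "0 < t" "t \<le> r" for t x
  proof -
    let ?z = "l + complex_of_real t"
    have "(\<lambda>k. blinfun_scaleC ((?z - l) powi (int k - int m)) (U k)) sums
        Blinfun (resolvent D A ?z)"
      using near[of ?z] t r by (simp add: dist_norm)
    then have "(\<lambda>k. blinfun_scaleC ((?z - l) powi (int k - int m)) (U k) x) sums
        Blinfun (resolvent D A ?z) x"
      by (rule bounded_linear.sums[OF blinfun.bounded_linear_left])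
    moreover have "Blinfun (resolvent D A ?z) x = R t x"
      using resolvent_clinear[OF res[OF t]]
      by (simp add: R_def bounded_clinear_def bounded_linear_Blinfun_apply)
    moreover have "blinfun_scaleC ((?z - l) powi (int k - int m)) (U k) x
        = (t powi (int k - int m)) *\<^sub>R U k x" for k
      by (simp add: blinfun_scaleC.rep_eq flip: scaleC_of_real of_real_power_int)
    ultimately have "(\<lambda>k. (t powi (int k - int m)) *\<^sub>R U k x) sums R t x" by simp
    then have "(\<lambda>k. t ^ m *\<^sub>R ((t powi (int k - int m)) *\<^sub>R U k x)) sums (t ^ m *\<^sub>R R t x)"
      by (rule sums_scaleR_right)
    moreover have "t ^ m * (t powi (int k - int m)) = t ^ k" for k
      using t by (simp add: power_int_diff)
    ultimately show ?thesis by simp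
  qed
  have lim0: "((\<lambda>t. t ^ m *\<^sub>R R t x) \<longlongrightarrow> U 0 x) (at_right 0)" for x
    by (rule power_series_tendsto_0[OF r(1) ser])
  have lim1: "((\<lambda>t. (t ^ m *\<^sub>R R t x - U 0 x) /\<^sub>R t) \<longlongrightarrow> U 1 x) (at_right 0)" for x
    by (rule power_series_tendsto_1[OF r(1) ser])
  have small: "eventually (\<lambda>t. 0 < t \<and> t \<le> r) (at_right 0)"
    unfolding eventually_at_right_field using r by (intro exI[of _ r]) auto
  have RD: "R t x \<in> D" and Rr: "L (R t x) = x - t *\<^sub>R R t x"
    and Rl: "y \<in> D \<Longrightarrow> R t (L y) = y - t *\<^sub>R R t y"
    and RC: "bounded_clinear (R t)" if t: "0 < t \<and> t \<le> r" for t x y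
  proof -
    have z: "l + complex_of_real t \<in> resolvent_set D A" using res t by blast
    show "R t x \<in> D" unfolding R_def by (rule resolvent_mem[OF z])
    show RC: "bounded_clinear (R t)" unfolding R_def by (rule resolvent_clinear[OF z])
    show "L (R t x) = x - t *\<^sub>R R t x"
      using resolvent_right[OF z, of x]
      by (simp add: R_def L_def complexification.scale_left_distrib scaleC_of_real algebra_simps)
    assume "y \<in> D"
    have "L y = ((l + complex_of_real t) *\<^sub>C y - A y) - t *\<^sub>R y"
      by (simp add: L_def complexification.scale_left_distrib scaleC_of_real)
    moreover have "bounded_linear (R t)" using RC by (simp add: bounded_clinear_def)
    ultimately have "R t (L y) = R t ((l + complex_of_real t) *\<^sub>C y - A y) - t *\<^sub>R R t y"
      by (simp add: linear_diff linear_scale bounded_linear.linear)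
    then show "R t (L y) = y - t *\<^sub>R R t y"
      using resolvent_left[OF z \<open>y \<in> D\<close>] by (simp add: R_def)
  qed
  \<comment> \<open>Closedness of \<open>L\<close>, from the existence of a resolvent:
    \<open>y t\<close> is the image of \<open>Ly t + r y t\<close> under the bounded operator
    \<open>R r\<close>, and so is the limit.\<close>
  have closed: "y0 \<in> D \<and> L y0 = g"
    if y: "(y \<longlongrightarrow> y0) (at_right 0)" and Ly: "(Ly \<longlongrightarrow> g) (at_right 0)"
      and ev: "eventually (\<lambda>t. y t \<in> D \<and> L (y t) = Ly t) (at_right (0 :: real))" for y y0 Ly g
  proof -
    have rr: "0 < r \<and> r \<le> r" using r by simp
    have RL: "bounded_linear (R r)" using RC[OF rr] by (simp add: bounded_clinear_def)
    have "eventually (\<lambda>t. y t = R r (Ly t + r *\<^sub>R y t)) (at_right 0)"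
      using ev
    proof eventually_elim
      case (elim t)
      then show ?case using Rl[OF rr, of "y t"]
        by (simp add: linear_add linear_scale bounded_linear.linear[OF RL])
    qed
    moreover have "((\<lambda>t. R r (Ly t + r *\<^sub>R y t)) \<longlongrightarrow> R r (g + r *\<^sub>R y0)) (at_right 0)"
      by (intro bounded_linear.tendsto[OF RL] tendsto_intros y Ly)
    ultimately have "(y \<longlongrightarrow> R r (g + r *\<^sub>R y0)) (at_right 0)"
      by (smt (verit) Lim_transform_eventually eventually_mono)
    then have y0: "y0 = R r (g + r *\<^sub>R y0)"
      using y tendsto_unique trivial_limit_at_right_real by blast
    then show ?thesis using RD[OF rr, of "g + r *\<^sub>R y0"] Rr[OF rr, of "g + r *\<^sub>R y0"] by simp
  qed
  have pw: "((\<lambda>t. t ^ n *\<^sub>R x) \<longlongrightarrow> 0 ^ n *\<^sub>R x) (at_right 0)" for n and x :: "'a complexification"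
    by (intro tendsto_intros)
  have tG: "((\<lambda>t. t *\<^sub>R (t ^ m *\<^sub>R R t x)) \<longlongrightarrow> 0) (at_right 0)" for x
  proof -
    have "((\<lambda>t. t *\<^sub>R (t ^ m *\<^sub>R R t x)) \<longlongrightarrow> 0 *\<^sub>R U 0 x) (at_right 0)"
      by (intro tendsto_intros lim0)
    then show ?thesis by simp
  qed

  \<comment> \<open>Equations for the two leading coefficients\<close>
  have P: "U 0 x \<in> D \<and> L (U 0 x) = 0" for x
  proof (rule closed[OF lim0])
    have "((\<lambda>t. t ^ m *\<^sub>R x - t *\<^sub>R (t ^ m *\<^sub>R R t x)) \<longlongrightarrow> 0 ^ m *\<^sub>R x - 0) (at_right 0)"
      by (intro tendsto_diff pw tG)
    then show "((\<lambda>t. t ^ m *\<^sub>R x - t *\<^sub>R (t ^ m *\<^sub>R R t x)) \<longlongrightarrow> 0) (at_right 0)"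
      using m by (simp add: zero_power)
    show "eventually (\<lambda>t. t ^ m *\<^sub>R R t x \<in> D \<and>
        L (t ^ m *\<^sub>R R t x) = t ^ m *\<^sub>R x - t *\<^sub>R (t ^ m *\<^sub>R R t x)) (at_right 0)"
      using small by eventually_elim
        (simp add: RD D_scaleR L_scaleR Rr scaleR_diff_right mult.commute)
  qed
  \<comment> \<open>The factor \<open>0 ^ (m - 1)\<close> is \<open>1\<close> for a pole of order
    one and \<open>0\<close> for a higher order, so one equation covers both cases.\<close>
  have Q: "U 1 x \<in> D \<and> L (U 1 x) = 0 ^ (m - 1) *\<^sub>R x - U 0 x" for x
  proof (rule closed[OF lim1])
    show "((\<lambda>t. t ^ (m - 1) *\<^sub>R x - t ^ m *\<^sub>R R t x) \<longlongrightarrow> 0 ^ (m - 1) *\<^sub>R x - U 0 x) (at_right 0)"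
      by (intro tendsto_diff pw lim0)
    show "eventually (\<lambda>t. (t ^ m *\<^sub>R R t x - U 0 x) /\<^sub>R t \<in> D \<and>
        L ((t ^ m *\<^sub>R R t x - U 0 x) /\<^sub>R t) = t ^ (m - 1) *\<^sub>R x - t ^ m *\<^sub>R R t x) (at_right 0)"
      using small
    proof eventually_elim
      case (elim t)
      have mm: "t ^ m = t * t ^ (m - 1)" using m by (cases m) auto
      have w: "t ^ m *\<^sub>R R t x - U 0 x \<in> D" using D_diff D_scaleR RD elim P by blast
      have "L (t ^ m *\<^sub>R R t x - U 0 x) = t ^ m *\<^sub>R (x - t *\<^sub>R R t x)"
        using elim by (simp add: L_diff L_scaleR D_scaleR RD P Rr)
      also have "\<dots> = t *\<^sub>R (t ^ (m - 1) *\<^sub>R x - t ^ m *\<^sub>R R t x)"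
        by (simp add: mm scaleR_diff_right mult_ac)
      finally show ?case
        using elim D_scaleR[OF w] L_scaleR[OF w, of "inverse t"] by simp
    qed
  qed

  \<comment> \<open>The order of the pole\<close>
  have kernel: "\<exists>k. x = k *\<^sub>C v0" if "x \<in> D" "L x \<in> D" "L (L x) = 0" for x
    by (rule simple_eigenvalue_span[OF simple v0])
      (use that in \<open>auto simp: generalised_eigenspace_def L_def intro!: exI[of _ "Suc (Suc 0)"]\<close>)
  have L0: "0 \<in> D" "L 0 = 0" using L_diff[OF v0D(1,1)] D_diff[OF v0D(1,1)] by auto
  \<comment> \<open>For \<open>m > 1\<close>, \<open>L (U 1 x) = - U 0 x\<close> lies in the kernel
    of \<open>L\<close>, so \<open>U 1 x\<close> belongs to the generalised eigenspace and is a
    multiple of \<open>v0\<close>. Then \<open>U 0 x = 0\<close> for all \<open>x\<close>, against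
    the choice of the leading coefficient.\<close>
  have "m = 1"
  proof (rule ccontr)
    assume "m \<noteq> 1"
    then have LU: "L (U 1 x) = - U 0 x" for x using Q m by simp
    have "U 0 x = 0" for x
    proof -
      have "- U 0 x \<in> D \<and> L (- U 0 x) = 0"
        using D_diff[OF L0(1), of "U 0 x"] L_diff[OF L0(1), of "U 0 x"] P L0 by simp
      then obtain k where "U 1 x = k *\<^sub>C v0" using kernel[of "U 1 x"] LU Q by metis
      then show ?thesis using LU[of x] L_scale[OF v0D(1), of k] v0D(3) by simp
    qed
    then show False using U0 by (metis blinfun_eqI zero_blinfun.rep_eq)
  qed
  then have Q: "U 1 x \<in> D \<and> L (U 1 x) = x - U 0 x" for x using Q by simp
  \<comment> \<open>Both limits come from \<open>R t (L x) = x - t R t x\<close> on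
    \<open>D\<close>, once multiplied by \<open>t\<close> and once as it stands.\<close>
  have left0: "U 0 (L x) = 0" and left1: "U 1 (L x) = x - U 0 x" if x: "x \<in> D" for x
  proof -
    have ev: "eventually (\<lambda>t. t *\<^sub>R (x - t *\<^sub>R R t x) = t ^ m *\<^sub>R R t (L x)) (at_right 0)"
      using small by eventually_elim (simp add: Rl x \<open>m = 1\<close>)
    have G: "((\<lambda>t. x - t *\<^sub>R R t x) \<longlongrightarrow> x - U 0 x) (at_right 0)"
      using lim0[of x] \<open>m = 1\<close> by (simp add: tendsto_diff)
    then have "((\<lambda>t. t *\<^sub>R (x - t *\<^sub>R R t x)) \<longlongrightarrow> 0 *\<^sub>R (x - U 0 x)) (at_right 0)"
      by (rule tendsto_scaleR[OF tendsto_ident_at])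
    then have "((\<lambda>t. t ^ m *\<^sub>R R t (L x)) \<longlongrightarrow> 0 *\<^sub>R (x - U 0 x)) (at_right 0)"
      using ev by (rule Lim_transform_eventually)
    then show 0: "U 0 (L x) = 0"
      using tendsto_unique[OF trivial_limit_at_right_real lim0] by fastforce
    have "eventually (\<lambda>t. x - t *\<^sub>R R t x = (t ^ m *\<^sub>R R t (L x) - U 0 (L x)) /\<^sub>R t) (at_right 0)"
      using small by eventually_elim (simp add: Rl x \<open>m = 1\<close> 0)
    with G have "((\<lambda>t. (t ^ m *\<^sub>R R t (L x) - U 0 (L x)) /\<^sub>R t) \<longlongrightarrow> x - U 0 x) (at_right 0)"
      by (rule Lim_transform_eventually)
    then show "U 1 (L x) = x - U 0 x"
      using tendsto_unique[OF trivial_limit_at_right_real lim1] by fastforce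
  qed
  have U0C: "U 0 (a *\<^sub>C x) = a *\<^sub>C U 0 x" and U1C: "U 1 (a *\<^sub>C x) = a *\<^sub>C U 1 x" for a x
  proof -
    have ev: "eventually (\<lambda>t. a *\<^sub>C (t ^ m *\<^sub>R R t x) = t ^ m *\<^sub>R R t (a *\<^sub>C x)) (at_right 0)"
      using small by eventually_elim
        (use RC in \<open>simp add: bounded_clinear_def scaleC_scaleR_commute\<close>)
    have "((\<lambda>t. a *\<^sub>C (t ^ m *\<^sub>R R t x)) \<longlongrightarrow> a *\<^sub>C U 0 x) (at_right 0)"
      by (intro bounded_linear.tendsto[OF bounded_linear_scaleC] lim0)
    then have "((\<lambda>t. t ^ m *\<^sub>R R t (a *\<^sub>C x)) \<longlongrightarrow> a *\<^sub>C U 0 x) (at_right 0)"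
      using ev by (rule Lim_transform_eventually)
    then show 0: "U 0 (a *\<^sub>C x) = a *\<^sub>C U 0 x"
      using tendsto_unique[OF trivial_limit_at_right_real lim0] by blast
    have "((\<lambda>t. a *\<^sub>C ((t ^ m *\<^sub>R R t x - U 0 x) /\<^sub>R t)) \<longlongrightarrow> a *\<^sub>C U 1 x) (at_right 0)"
      by (intro bounded_linear.tendsto[OF bounded_linear_scaleC] lim1)
    moreover have "eventually (\<lambda>t. a *\<^sub>C ((t ^ m *\<^sub>R R t x - U 0 x) /\<^sub>R t)
        = (t ^ m *\<^sub>R R t (a *\<^sub>C x) - U 0 (a *\<^sub>C x)) /\<^sub>R t) (at_right 0)"
      using ev by eventually_elim
        (simp add: 0 scaleC_scaleR_commute complexification.scale_right_diff_distrib)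
    ultimately have "((\<lambda>t. (t ^ m *\<^sub>R R t (a *\<^sub>C x) - U 0 (a *\<^sub>C x)) /\<^sub>R t) \<longlongrightarrow> a *\<^sub>C U 1 x)
        (at_right 0)"
      by (rule Lim_transform_eventually)
    then show "U 1 (a *\<^sub>C x) = a *\<^sub>C U 1 x"
      using tendsto_unique[OF trivial_limit_at_right_real lim1] by blast
  qed

  \<comment> \<open>The functional \<open>\<phi>\<close> and the reduced resolvent
    \<open>S\<close>\<close>
  have "\<exists>k. U 0 x = k *\<^sub>C v0" for x using kernel[of "U 0 x"] P L0 by simp
  then obtain \<phi> where \<phi>: "\<And>x. U 0 x = \<phi> x *\<^sub>C v0" by metis
  have \<phi>_add: "\<phi> (x + y) = \<phi> x + \<phi> y" for x y
  proof -
    have "\<phi> (x + y) *\<^sub>C v0 = (\<phi> x + \<phi> y) *\<^sub>C v0"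
      using blinfun.add_right[of "U 0" x y] by (simp add: \<phi> complexification.scale_left_distrib)
    then show ?thesis using v0D(2) complexification.scale_cancel_right by blast
  qed
  have \<phi>_scale: "\<phi> (a *\<^sub>C x) = a * \<phi> x" for a x
  proof -
    have "\<phi> (a *\<^sub>C x) *\<^sub>C v0 = (a * \<phi> x) *\<^sub>C v0" using U0C[of a x] by (simp add: \<phi>)
    then show ?thesis using v0D(2) complexification.scale_cancel_right by blast
  qed
  have \<phi>_bound: "cmod (\<phi> x) \<le> norm (U 0) / norm v0 * norm x" for x
    using norm_blinfun[of "U 0" x] v0D(2) by (simp add: \<phi> norm_scaleC field_simps)
  have "\<phi> v0 = 1"
  proof -
    have "\<phi> v0 *\<^sub>C v0 = 1 *\<^sub>C v0" using left1[OF v0D(1)] v0D(3) by (simp add: \<phi> blinfun.zero_right)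
    then show ?thesis using v0D(2) complexification.scale_cancel_right by blast
  qed
  \<comment> \<open>Subtracting the \<open>v0\<close> component enforces
    \<open>\<phi> (S x) = 0\<close> and leaves \<open>L (S x)\<close> unchanged, as
    \<open>L v0 = 0\<close>.\<close>
  define S where "S x = U 1 x - \<phi> (U 1 x) *\<^sub>C v0" for x
  have \<phi>_diff: "\<phi> (x - y) = \<phi> x - \<phi> y" for x y
    using \<phi>_add[of "x - y" y] by simp
  have "simple_pole D A S l v0 \<phi>"
  proof
    show "\<exists>K\<ge>0. \<forall>x. cmod (\<phi> x) \<le> K * norm x"
      using \<phi>_bound by (intro exI[of _ "norm (U 0) / norm v0"]) auto
    have "S = (\<lambda>x. U 1 x - U 0 (U 1 x))" by (simp add: S_def \<phi> fun_eq_iff)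
    moreover have "bounded_linear (\<lambda>x. U 1 x - U 0 (U 1 x))"
      by (intro bounded_linear_sub blinfun.bounded_linear_right
          bounded_linear_compose[OF blinfun.bounded_linear_right])
    ultimately show "bounded_clinear S"
      by (simp add: bounded_clinear_def U0C U1C complexification.scale_right_diff_distrib
          del: One_nat_def)
    fix x
    have kv: "k *\<^sub>C v0 \<in> D" "L (k *\<^sub>C v0) = 0" for k
      using D_scale[OF v0D(1), of k] L_scale[OF v0D(1), of k] v0D(3) by auto
    show "S x \<in> D" unfolding S_def using D_diff Q kv by blast
    have "L (S x) = x - \<phi> x *\<^sub>C v0"
      unfolding S_def using Q[of x] kv by (simp add: L_diff \<phi> del: One_nat_def)
    then show "l *\<^sub>C S x - A (S x) = x - \<phi> x *\<^sub>C v0" by (simp add: L_def)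
    show "\<phi> (S x) = 0" by (simp add: S_def \<phi>_diff \<phi>_scale \<open>\<phi> v0 = 1\<close>)
    assume "x \<in> D"
    then have "S (L x) = x - \<phi> x *\<^sub>C v0"
      by (simp add: S_def left1 \<phi> \<phi>_diff \<phi>_scale \<open>\<phi> v0 = 1\<close> del: One_nat_def)
    then show "S (l *\<^sub>C x - A x) = x - \<phi> x *\<^sub>C v0" by (simp add: L_def)
  qed (use D_add D_scale \<phi>_add \<phi>_scale v0 in auto)
  then show thesis by (rule that)
qed

section \<open>Perturbation of a simple pole\<close>

context simple_pole
begin

lemma v0_mem: "v0 \<in> D" and v0_nonzero: "v0 \<noteq> 0" and A_v0: "A v0 = l *\<^sub>C v0"
  using v0 by (auto simp: eigenvector_def)

lemma S_bounded: "bounded_linear S" and S_scale: "S (a *\<^sub>C x) = a *\<^sub>C S x"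
  using S by (auto simp: bounded_clinear_def)

lemma S_add: "S (x + y) = S x + S y" and S_diff: "S (x - y) = S x - S y"
  and S_scaleR: "S (r *\<^sub>R x) = r *\<^sub>R S x" and S_zero: "S 0 = 0"
  using bounded_linear.linear[OF S_bounded]
  by (auto simp: linear_add linear_diff linear_scale linear_0)

lemma \<phi>_diff: "\<phi> (x - y) = \<phi> x - \<phi> y"
  using \<phi>_add[of "x - y" y] by simp

lemma \<phi>_scaleR: "\<phi> (r *\<^sub>R x) = of_real r * \<phi> x"
  using \<phi>_scale[of "of_real r" x] by (simp add: scaleC_of_real)

lemma D_diff: "x \<in> D \<Longrightarrow> y \<in> D \<Longrightarrow> x - y \<in> D"
  using D_add[of x "(-1) *\<^sub>C y"] D_scale[of y "-1"] by simp

lemma A_diff: "x \<in> D \<Longrightarrow> y \<in> D \<Longrightarrow> A (x - y) = A x - A y"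
  using A_add[of "x - y" y] D_diff by simp

lemma \<phi>_v0: "\<phi> v0 = 1"
proof -
  have "\<phi> v0 *\<^sub>C v0 = 1 *\<^sub>C v0" using S_left[OF v0_mem] by (simp add: A_v0 S_zero)
  then show ?thesis using v0_nonzero complexification.scale_cancel_right by blast
qed

text \<open>With \<open>y = (l - A) x\<close>, the vector \<open>S y = x - \<phi> x v0\<close> is
  mapped by \<open>l - A\<close> to \<open>y\<close>, as \<open>v0\<close> is in the kernel, but
  also to \<open>y - \<phi> y v0\<close> by \<open>S_right\<close>.\<close>

lemma \<phi>_range:
  assumes "x \<in> D"
  shows "\<phi> (l *\<^sub>C x - A x) = 0"
proof -
  let ?y = "l *\<^sub>C x - A x"
  have "A (x - \<phi> x *\<^sub>C v0) = A x - \<phi> x *\<^sub>C (l *\<^sub>C v0)"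
    using assms v0_mem by (simp add: A_diff A_scale A_v0 D_scale)
  then have "l *\<^sub>C (x - \<phi> x *\<^sub>C v0) - A (x - \<phi> x *\<^sub>C v0) = ?y"
    by (simp add: complexification.scale_right_diff_distrib mult.commute)
  then have "\<phi> ?y *\<^sub>C v0 = 0"
    using S_right[of ?y] S_left[OF assms] by simp
  then show ?thesis using v0_nonzero by simp
qed

text \<open>The Fredholm alternative for \<open>l - A\<close>: the solvability condition and the
  form of every solution.\<close>

lemma solution_decomposition:
  assumes "y \<in> D" "l *\<^sub>C y - A y = g"
  shows "\<phi> g = 0" "y = \<phi> y *\<^sub>C v0 + S g"
  using \<phi>_range[OF assms(1)] S_left[OF assms(1)] assms(2) by auto

text \<open>An eigenvector of \<open>A + \<kappa> B\<close> normalised by \<open>\<phi> v = 1\<close> is the same as a fixed point of this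
  map; applying \<open>\<phi>\<close> to the eigenvalue equation yields the eigenvalue \<open>l + \<kappa> \<phi>(B v)\<close>.\<close>

definition perturbation_map ::
    "('a complexification \<Rightarrow> 'a complexification) \<Rightarrow> real \<Rightarrow> 'a complexification \<Rightarrow> 'a complexification"
  where "perturbation_map B \<kappa> v = v0 + \<kappa> *\<^sub>R (S (B v) - \<phi> (B v) *\<^sub>C S v)"

text \<open>The fixed point equation reads \<open>v = v0 + S g\<close>. As \<open>\<phi>\<close>
  vanishes on the range of \<open>S\<close>, it forces \<open>\<phi> v = 1\<close> and then
  \<open>\<phi> g = 0\<close>, which is the condition for \<open>S g\<close> to solve
  \<open>(l - A) y = g\<close>.\<close>

lemma perturbation_map_fixed_point:
  assumes fp: "perturbation_map B \<kappa> v = v"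
  shows "eigenvector D (\<lambda>x. A x + \<kappa> *\<^sub>R B x) (l + of_real \<kappa> * \<phi> (B v)) v" "\<phi> v = 1"
proof -
  define g where "g = \<kappa> *\<^sub>R (B v - \<phi> (B v) *\<^sub>C v)"
  have v: "v = v0 + S g"
    using fp by (simp add: perturbation_map_def g_def S_scaleR S_diff S_scale)
  show "\<phi> v = 1" by (subst v) (simp add: \<phi>_add \<phi>_v0 \<phi>_S)
  then have "\<phi> g = 0" by (simp add: g_def \<phi>_scaleR \<phi>_diff \<phi>_scale)
  then have "l *\<^sub>C S g - A (S g) = g" using S_right[of g] by simp
  moreover have "v \<in> D" by (subst v) (intro D_add v0_mem S_range)
  moreover have "A v = A v0 + A (S g)" by (subst v) (intro A_add v0_mem S_range)
  moreover have "l *\<^sub>C v = l *\<^sub>C v0 + l *\<^sub>C S g"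
    by (subst v) (rule complexification.scale_right_distrib)
  ultimately have "A v = l *\<^sub>C v - g" by (simp add: A_v0 algebra_simps)
  then have "A v + \<kappa> *\<^sub>R B v = (l + of_real \<kappa> * \<phi> (B v)) *\<^sub>C v"
    by (simp add: g_def complexification.scale_left_distrib scaleC_of_real scaleR_diff_right
        flip: complexification.scale_scale)
  moreover have "v \<noteq> 0" using \<open>\<phi> v = 1\<close> \<phi>_scale[of 0 0] by auto
  ultimately show "eigenvector D (\<lambda>x. A x + \<kappa> *\<^sub>R B x) (l + of_real \<kappa> * \<phi> (B v)) v"
    using \<open>v \<in> D\<close> by (simp add: eigenvector_def)
qed

text \<open>Second eigenvectors and Jordan chains are excluded together: if
  \<open>N y = a v\<close>, the part \<open>w\<close> of \<open>y\<close> killed by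
  \<open>\<phi>\<close> satisfies a homogeneous linear equation whose right-hand side is a strict
  contraction in \<open>w\<close>, so \<open>w = 0\<close>.\<close>

lemma perturbed_simple:
  assumes fp: "perturbation_map B \<kappa> v = v" and B: "bounded_clinear B"
    and bS: "\<And>x. norm (S x) \<le> KS * norm x" "0 \<le> KS"
    and bB: "\<And>x. norm (B x) \<le> KB * norm x" "0 \<le> KB"
    and b\<phi>: "\<And>x. cmod (\<phi> x) \<le> K\<phi> * norm x" "0 \<le> K\<phi>"
    and small: "\<bar>\<kappa>\<bar> * (KS * KB + 2 * (K\<phi> * KB * (KS * norm v))) < 1"
  shows "algebraically_simple_eigenvalue D (\<lambda>x. A x + \<kappa> *\<^sub>R B x) (l + of_real \<kappa> * \<phi> (B v))"
proof -
  define \<mu> where "\<mu> = l + of_real \<kappa> * \<phi> (B v)"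
  define N where "N x = \<mu> *\<^sub>C x - (A x + \<kappa> *\<^sub>R B x)" for x
  have lB: "B (x - y) = B x - B y" "B (a *\<^sub>C x) = a *\<^sub>C B x" for x y a
    using B by (auto simp: bounded_clinear_def linear_diff bounded_linear.linear)
  have v: "v \<in> D" "v \<noteq> 0" "N v = 0" "\<phi> v = 1"
    using perturbation_map_fixed_point[OF fp] by (auto simp: eigenvector_def N_def \<mu>_def)
  have chain: "a = 0 \<and> y = \<phi> y *\<^sub>C v" if y: "y \<in> D" "N y = a *\<^sub>C v" for y a
  proof -
    define w where "w = y - \<phi> y *\<^sub>C v"
    have w: "w \<in> D" "\<phi> w = 0"
      unfolding w_def using y v by (auto intro!: D_diff D_scale simp: \<phi>_diff \<phi>_scale)
    have "N w = N y - \<phi> y *\<^sub>C N v"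
      using y(1) v(1)
      by (simp add: N_def w_def A_diff A_scale D_scale lB complexification.scale_right_diff_distrib
          complexification.scale_right_distrib scaleC_scaleR_commute scaleR_diff_right algebra_simps)
    then have Nw: "N w = a *\<^sub>C v" using y v by simp
    define g where "g = \<kappa> *\<^sub>R (B w - \<phi> (B v) *\<^sub>C w) + a *\<^sub>C v"
    have "\<mu> *\<^sub>C w = l *\<^sub>C w + \<kappa> *\<^sub>R (\<phi> (B v) *\<^sub>C w)"
      by (simp add: \<mu>_def complexification.scale_left_distrib scaleC_of_real
          flip: complexification.scale_scale)
    then have "l *\<^sub>C w - A w = g"
      using Nw by (simp add: N_def g_def algebra_simps)
    note sol = solution_decomposition[OF w(1) this]
    \<comment> \<open>The solvability condition \<open>\<phi> g = 0\<close> expresses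
      \<open>a\<close> through \<open>w\<close>; inserting this leaves an equation in
      \<open>w\<close> alone.\<close>
    have a: "a = - (of_real \<kappa> * \<phi> (B w))"
      using sol(1) w v
      by (simp add: g_def \<phi>_add \<phi>_scaleR \<phi>_diff \<phi>_scale eq_neg_iff_add_eq_0 add.commute)
    have weq: "w = \<kappa> *\<^sub>R (S (B w) - \<phi> (B v) *\<^sub>C S w - \<phi> (B w) *\<^sub>C S v)"
    proof -
      have "a *\<^sub>C S v = - (\<kappa> *\<^sub>R (\<phi> (B w) *\<^sub>C S v))"
        by (simp add: a scaleC_of_real flip: complexification.scale_scale)
      then show ?thesis
        using sol(2) w by (simp add: g_def S_add S_scaleR S_diff S_scale scaleR_diff_right)
    qed
    have b\<phi>B: "cmod (\<phi> (B x)) \<le> K\<phi> * (KB * norm x)" for x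
      using b\<phi>(1)[of "B x"] mult_left_mono[OF bB(1)[of x] b\<phi>(2)] by linarith
    have bSB: "norm (S (B x)) \<le> KS * (KB * norm x)" for x
      using bS(1)[of "B x"] mult_left_mono[OF bB(1)[of x] bS(2)] by linarith
    have "norm (S (B w) - \<phi> (B v) *\<^sub>C S w - \<phi> (B w) *\<^sub>C S v)
        \<le> norm (S (B w)) + cmod (\<phi> (B v)) * norm (S w) + cmod (\<phi> (B w)) * norm (S v)"
      using norm_triangle_ineq4[of "S (B w) - \<phi> (B v) *\<^sub>C S w" "\<phi> (B w) *\<^sub>C S v"]
        norm_triangle_ineq4[of "S (B w)" "\<phi> (B v) *\<^sub>C S w"] by (simp add: norm_scaleC)
    also have "\<dots> \<le> KS * (KB * norm w) + K\<phi> * (KB * norm v) * (KS * norm w)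
        + K\<phi> * (KB * norm w) * (KS * norm v)"
      using bS bB b\<phi> by (intro add_mono mult_mono b\<phi>B bSB) (auto intro!: mult_nonneg_nonneg)
    also have "\<dots> = (KS * KB + 2 * (K\<phi> * KB * (KS * norm v))) * norm w"
      by (simp add: algebra_simps)
    finally have "\<bar>\<kappa>\<bar> * norm (S (B w) - \<phi> (B v) *\<^sub>C S w - \<phi> (B w) *\<^sub>C S v)
        \<le> \<bar>\<kappa>\<bar> * ((KS * KB + 2 * (K\<phi> * KB * (KS * norm v))) * norm w)"
      by (rule mult_left_mono) simp
    then have "norm w \<le> \<bar>\<kappa>\<bar> * (KS * KB + 2 * (K\<phi> * KB * (KS * norm v))) * norm w"
      by (subst (1) weq) (simp add: mult.assoc)
    then have "w = 0"
      using small by (metis mult_less_cancel_right2 norm_le_zero_iff not_le)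
    then show ?thesis using a lB(1)[of 0 0] \<phi>_scale[of 0 0] by (simp add: w_def)
  qed
  \<comment> \<open>By induction \<open>N x\<close> is a multiple of \<open>v\<close>, and
    \<open>chain\<close> transfers this to \<open>x\<close>.\<close>
  have iter: "\<exists>a. x = a *\<^sub>C v" if "x \<in> power_domain D N n" "(N ^^ n) x = 0" for n x
    using that
  proof (induction n arbitrary: x)
    case 0
    then have "x = 0 *\<^sub>C v" by simp
    then show ?case by blast
  next
    case (Suc n)
    then have "x \<in> D" "N x \<in> power_domain D N n" "(N ^^ n) (N x) = 0"
      by (auto simp: funpow_swap1)
    then show ?case using Suc.IH[of "N x"] chain by blast
  qed
  let ?V = "generalised_eigenspace D (\<lambda>x. A x + \<kappa> *\<^sub>R B x) \<mu>"
  have V: "?V = (\<Union>n. {x \<in> power_domain D N n. (N ^^ n) x = 0})"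
    unfolding generalised_eigenspace_def N_def ..
  have "?V \<subseteq> complexification.span {v}"
    unfolding V complexification.span_singleton using iter by blast
  moreover have "v \<in> ?V" unfolding V using v by (intro UN_I[of "Suc 0"]) auto
  ultimately have "complexification.dim ?V = 1"
    by (intro complexification.dim_unique[of "{v}"])
      (use v(2) in auto)
  moreover have "eigenvalue D (\<lambda>x. A x + \<kappa> *\<^sub>R B x) \<mu>"
    using perturbation_map_fixed_point[OF fp] by (auto simp: eigenvalue_def \<mu>_def)
  ultimately show ?thesis by (simp add: algebraically_simple_eigenvalue_def \<mu>_def)
qed

end

text \<open>Write \<open>S x = a + \<i> b\<close> with \<open>a\<close>, \<open>b\<close> real. The
  imaginary part of \<open>S_right\<close> says that \<open>(l - A) b\<close> is
  \<open>- Im (\<phi> x)\<close> times \<open>v0\<close>; applying \<open>\<phi>\<close>, which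
  vanishes on the range of \<open>l - A\<close>, gives \<open>Im (\<phi> x) = 0\<close>. So
  \<open>b\<close> is in the kernel, and \<open>\<phi> (S x) = 0\<close> leaves
  \<open>b = 0\<close>.\<close>

lemma (in simple_pole) \<phi>_S_real:
  assumes real: "real_operator D A" and l: "Im l = 0" and v0_real: "imag_part v0 = 0"
    and x: "imag_part x = 0"
  shows "Im (\<phi> x) = 0" "imag_part (S x) = 0"
proof -
  have D_eq: "D = {x + \<i> *\<^sub>C y | x y. x \<in> D \<inter> real_space \<and> y \<in> D \<inter> real_space}"
    and A_real: "A ` (D \<inter> real_space) \<subseteq> real_space"
    using real unfolding real_operator_def by blast+
  \<comment> \<open>Stated for all real vectors, because its first half is applied again to the
    components \<open>a\<close> and \<open>b\<close> of \<open>S x\<close>.\<close>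
  have split: "Im (\<phi> x) = 0 \<and>
      (\<exists>a b. S x = a + \<i> *\<^sub>C b \<and> a \<in> D \<and> imag_part a = 0 \<and> b \<in> D \<and> imag_part b = 0 \<and>
        S (l *\<^sub>C b - A b) = 0)"
    if x: "imag_part x = 0" for x
  proof -
    have "\<exists>a b. S x = a + \<i> *\<^sub>C b \<and> a \<in> D \<inter> real_space \<and> b \<in> D \<inter> real_space"
      using S_range[of x] by (subst (asm) D_eq) blast
    then obtain a b where ab: "S x = a + \<i> *\<^sub>C b" "a \<in> D" "imag_part a = 0" "b \<in> D" "imag_part b = 0"
      by (auto simp: mem_real_space_iff)
    have Aab: "imag_part (A a) = 0" "imag_part (A b) = 0"
      using A_real ab by (auto simp: mem_real_space_iff image_subset_iff)
    have "x - \<phi> x *\<^sub>C v0 = l *\<^sub>C S x - A (S x)" using S_right[of x] by simp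
    also have "\<dots> = (l *\<^sub>C a - A a) + \<i> *\<^sub>C (l *\<^sub>C b - A b)"
      using ab(2,4)
      by (simp add: ab(1) A_add A_scale D_scale complexification.scale_right_distrib
          complexification.scale_right_diff_distrib mult.commute)
    finally have "x - \<phi> x *\<^sub>C v0 = (l *\<^sub>C a - A a) + \<i> *\<^sub>C (l *\<^sub>C b - A b)" .
    then have "imag_part (x - \<phi> x *\<^sub>C v0) = real_part (l *\<^sub>C b - A b)"
      using ab Aab l by simp
    then have b: "l *\<^sub>C b - A b = complex_of_real (- Im (\<phi> x)) *\<^sub>C v0"
      using x l ab Aab v0_real by (simp add: complexification_eq_iff)
    then have "complex_of_real (- Im (\<phi> x)) = 0"
      using \<phi>_range[OF ab(4)] by (simp only: b \<phi>_scale \<phi>_v0 mult_1_right)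
    then have "Im (\<phi> x) = 0" "S (l *\<^sub>C b - A b) = 0" using b S_zero by auto
    then show ?thesis using ab by blast
  qed
  show "Im (\<phi> x) = 0" using split[OF x] by blast
  obtain a b where ab: "S x = a + \<i> *\<^sub>C b" "a \<in> D" "imag_part a = 0" "b \<in> D" "imag_part b = 0"
    "S (l *\<^sub>C b - A b) = 0"
    using split[OF x] by blast
  have "\<phi> a + \<i> * \<phi> b = 0" using \<phi>_S[of x] by (simp add: ab \<phi>_add \<phi>_scale)
  moreover have "Im (\<phi> a) = 0" "Im (\<phi> b) = 0" using split ab by blast+
  ultimately have "\<phi> b = 0" by (simp add: complex_eq_iff)
  then have "b = 0" using S_left[OF ab(4)] ab(6) by simp
  then show "imag_part (S x) = 0" using ab by simp
qed

text \<open>Gauge bounds make the order ball around \<open>v0\<close> invariant, norm bounds make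
  the map a contraction there. The closed invariant set \<open>Z\<close> is a parameter so that
  fixed points can be confined to real vectors.\<close>

lemma (in simple_pole) perturbed_eigenvector_exists:
  assumes B: "bounded_clinear B" and u: "0 \<le> u" and r: "0 < r"
    and gS: "0 \<le> K1" "\<And>x k. 0 \<le> k \<Longrightarrow> modulus x \<le> k *\<^sub>R u \<Longrightarrow> modulus (S x) \<le> (K1 * k) *\<^sub>R u"
    and gB: "0 \<le> K2" "\<And>x k. 0 \<le> k \<Longrightarrow> modulus x \<le> k *\<^sub>R u \<Longrightarrow> modulus (B x) \<le> (K2 * k) *\<^sub>R u"
    and gv0: "0 \<le> k0" "modulus v0 \<le> k0 *\<^sub>R u"
    and Z: "closed Z" "v0 \<in> Z" "\<And>\<kappa> v. v \<in> Z \<Longrightarrow> perturbation_map B \<kappa> v \<in> Z"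
  shows "\<exists>\<delta>>0. \<forall>\<kappa>. \<bar>\<kappa>\<bar> < \<delta> \<longrightarrow> (\<exists>v\<in>Z. modulus (v - v0) \<le> r *\<^sub>R u \<and>
    perturbation_map B \<kappa> v = v \<and>
    algebraically_simple_eigenvalue D (\<lambda>x. A x + \<kappa> *\<^sub>R B x) (l + of_real \<kappa> * \<phi> (B v)))"
proof -
  have B': "bounded_linear B" using B by (simp add: bounded_clinear_def)
  have B_diff: "B (x - y) = B x - B y" for x y
    using B' by (simp add: linear_diff bounded_linear.linear)
  obtain KS where KS: "0 \<le> KS" "\<And>x. norm (S x) \<le> KS * norm x"
    using bounded_linear.nonneg_bounded[OF S_bounded] by (auto simp: mult.commute)
  obtain KB where KB: "0 \<le> KB" "\<And>x. norm (B x) \<le> KB * norm x"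
    using bounded_linear.nonneg_bounded[OF B'] by (auto simp: mult.commute)
  obtain K\<phi> where K\<phi>: "0 \<le> K\<phi>" "\<And>x. cmod (\<phi> x) \<le> K\<phi> * norm x"
    using \<phi>_bounded by blast
  have b\<phi>B: "cmod (\<phi> (B x)) \<le> K\<phi> * (KB * norm x)" for x
    using K\<phi>(2)[of "B x"] mult_left_mono[OF KB(2)[of x] K\<phi>(1)] by linarith
  have bSB: "norm (S (B x)) \<le> KS * (KB * norm x)" for x
    using KS(2)[of "B x"] mult_left_mono[OF KB(2)[of x] KS(1)] by linarith
  define b where "b = k0 + r"
  define n where "n = b * norm u"
  have b0: "0 \<le> b" and n0: "0 \<le> n" using gv0 r by (auto simp: b_def n_def)
  \<comment> \<open>Multiplied by the absolute value of \<open>\<kappa>\<close>, \<open>Q1\<close>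
    bounds the gauge of the displacement from \<open>v0\<close>, and \<open>Q2\<close> bounds the
    Lipschitz constant in norm as well as the quantity required small in
    \<open>perturbed_simple\<close>.\<close>
  define Q1 where "Q1 = K1 * (K2 * b) + K\<phi> * (KB * n) * (K1 * b)"
  define Q2 where "Q2 = KS * KB + 2 * (K\<phi> * KB * (KS * n))"
  have Q: "0 \<le> Q1" "0 \<le> Q2"
    unfolding Q1_def Q2_def using gS(1) gB(1) KS(1) KB(1) K\<phi>(1) b0 n0 by simp_all
  \<comment> \<open>The minimum serves both demands, displacement at most \<open>r\<close> and
    contraction factor at most \<open>1 / 2\<close>; the summand \<open>1\<close> keeps the
    denominator positive.\<close>
  define \<delta> where "\<delta> = min r (1 / 2) / (Q1 + Q2 + 1)"
  have \<delta>: "0 < \<delta>" using Q r by (simp add: \<delta>_def)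
  define X where "X = {v. v - v0 \<in> {z. modulus z \<le> r *\<^sub>R u}} \<inter> Z"
  have X_bound: "modulus v \<le> b *\<^sub>R u" "norm v \<le> n" if "v \<in> X" for v
  proof -
    have "modulus v \<le> modulus (v - v0) + modulus v0" using modulus_triangle[of "v - v0" v0] by simp
    also have "\<dots> \<le> r *\<^sub>R u + k0 *\<^sub>R u" using that gv0 by (intro add_mono) (auto simp: X_def)
    finally show 1: "modulus v \<le> b *\<^sub>R u" by (simp add: b_def scaleR_add_left add.commute)
    show "norm v \<le> n" using norm_le_of_modulus_le[OF 1] b0 by (simp add: n_def)
  qed
  have "complete X"
  proof -
    have "closed ((\<lambda>v. v - v0) -` {z. modulus z \<le> r *\<^sub>R u})"
      by (intro closed_vimage closed_modulus_le continuous_intros)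
    then show ?thesis
      unfolding X_def complete_eq_closed using Z(1) by (intro closed_Int) (simp_all add: vimage_def)
  qed
  moreover have "v0 \<in> X" using Z(2) r u by (simp add: X_def scaleR_nonneg_nonneg)
  moreover have "\<exists>v\<in>X. perturbation_map B \<kappa> v = v \<and> \<bar>\<kappa>\<bar> * Q2 \<le> 1 / 2" if \<kappa>: "\<bar>\<kappa>\<bar> < \<delta>" for \<kappa>
  proof -
    have "\<bar>\<kappa>\<bar> * (Q1 + Q2 + 1) \<le> min r (1 / 2)"
      using \<kappa> Q by (simp add: \<delta>_def pos_less_divide_eq less_imp_le)
    moreover have "\<bar>\<kappa>\<bar> * Q1 \<le> \<bar>\<kappa>\<bar> * (Q1 + Q2 + 1)" "\<bar>\<kappa>\<bar> * Q2 \<le> \<bar>\<kappa>\<bar> * (Q1 + Q2 + 1)"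
      using Q by (auto intro!: mult_left_mono)
    ultimately have kQ: "\<bar>\<kappa>\<bar> * Q1 \<le> r" "\<bar>\<kappa>\<bar> * Q2 \<le> 1 / 2" by linarith+
    have self: "perturbation_map B \<kappa> v \<in> X" if v: "v \<in> X" for v
    proof -
      have "modulus (S (B v) - \<phi> (B v) *\<^sub>C S v) \<le> modulus (S (B v)) + cmod (\<phi> (B v)) *\<^sub>R modulus (S v)"
        using modulus_diff_le by (metis modulus_scaleC)
      also have "\<dots> \<le> (K1 * (K2 * b)) *\<^sub>R u + (K\<phi> * (KB * n)) *\<^sub>R ((K1 * b) *\<^sub>R u)"
      proof (intro add_mono scaleR_mono)
        show "modulus (S (B v)) \<le> (K1 * (K2 * b)) *\<^sub>R u"
          using gB(1) b0 X_bound(1)[OF v] by (intro gS(2) gB(2)) auto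
        show "modulus (S v) \<le> (K1 * b) *\<^sub>R u" using b0 X_bound(1)[OF v] by (intro gS(2))
        have "K\<phi> * (KB * norm v) \<le> K\<phi> * (KB * n)"
          using X_bound(2)[OF v] by (intro mult_left_mono K\<phi>(1) KB(1))
        then show "cmod (\<phi> (B v)) \<le> K\<phi> * (KB * n)" using b\<phi>B[of v] by linarith
      qed (use K\<phi>(1) KB(1) n0 in auto)
      also have "\<dots> = Q1 *\<^sub>R u" by (simp add: Q1_def scaleR_add_left)
      finally have "\<bar>\<kappa>\<bar> *\<^sub>R modulus (S (B v) - \<phi> (B v) *\<^sub>C S v) \<le> \<bar>\<kappa>\<bar> *\<^sub>R (Q1 *\<^sub>R u)"
        by (rule scaleR_left_mono) simp
      also have "\<dots> \<le> r *\<^sub>R u" using kQ(1) u by (simp add: scaleR_right_mono)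
      finally have "modulus (perturbation_map B \<kappa> v - v0) \<le> r *\<^sub>R u"
        by (simp add: perturbation_map_def modulus_scaleR)
      then show ?thesis using v Z(3) by (simp add: X_def)
    qed
    have contr: "dist (perturbation_map B \<kappa> v) (perturbation_map B \<kappa> w) \<le> 1 / 2 * dist v w"
      if v: "v \<in> X" and w: "w \<in> X" for v w
    proof -
      let ?d = "v - w"
      \<comment> \<open>The quadratic term is split as a product difference, with increments in one
        factor at a time.\<close>
      have "perturbation_map B \<kappa> v - perturbation_map B \<kappa> w
          = \<kappa> *\<^sub>R (S (B ?d) - \<phi> (B ?d) *\<^sub>C S v - \<phi> (B w) *\<^sub>C S ?d)"
        by (simp add: perturbation_map_def B_diff S_diff \<phi>_diff algebra_simps
            complexification.scale_left_diff_distrib complexification.scale_right_diff_distrib)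
      then have eq: "dist (perturbation_map B \<kappa> v) (perturbation_map B \<kappa> w)
          = \<bar>\<kappa>\<bar> * norm (S (B ?d) - \<phi> (B ?d) *\<^sub>C S v - \<phi> (B w) *\<^sub>C S ?d)"
        by (simp add: dist_norm)
      have "norm (S (B ?d) - \<phi> (B ?d) *\<^sub>C S v - \<phi> (B w) *\<^sub>C S ?d)
          \<le> norm (S (B ?d)) + cmod (\<phi> (B ?d)) * norm (S v) + cmod (\<phi> (B w)) * norm (S ?d)"
        using norm_triangle_ineq4[of "S (B ?d) - \<phi> (B ?d) *\<^sub>C S v" "\<phi> (B w) *\<^sub>C S ?d"]
          norm_triangle_ineq4[of "S (B ?d)" "\<phi> (B ?d) *\<^sub>C S v"] by (simp add: norm_scaleC)
      also have "\<dots> \<le> KS * (KB * norm ?d) + K\<phi> * (KB * norm ?d) * (KS * n)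
          + K\<phi> * (KB * n) * (KS * norm ?d)"
      proof (intro add_mono mult_mono b\<phi>B bSB KS(2))
        show "norm (S v) \<le> KS * n"
          using KS(2)[of v] mult_left_mono[OF X_bound(2)[OF v] KS(1)] by linarith
        have "K\<phi> * (KB * norm w) \<le> K\<phi> * (KB * n)"
          using X_bound(2)[OF w] by (intro mult_left_mono K\<phi>(1) KB(1))
        then show "cmod (\<phi> (B w)) \<le> K\<phi> * (KB * n)" using b\<phi>B[of w] by linarith
      qed (use K\<phi>(1) KB(1) n0 in auto)
      also have "\<dots> = Q2 * norm ?d" by (simp add: Q2_def algebra_simps)
      finally have "\<bar>\<kappa>\<bar> * norm (S (B ?d) - \<phi> (B ?d) *\<^sub>C S v - \<phi> (B w) *\<^sub>C S ?d)
          \<le> \<bar>\<kappa>\<bar> * (Q2 * norm ?d)" by (rule mult_left_mono) simp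
      also have "\<dots> \<le> 1 / 2 * norm ?d"
        using mult_right_mono[OF kQ(2) norm_ge_zero[of ?d]] by (simp add: mult.assoc)
      finally show ?thesis unfolding eq by (simp add: dist_norm)
    qed
    have "\<exists>!v\<in>X. perturbation_map B \<kappa> v = v"
      by (rule Banach_fix[of X "1/2"]) (use \<open>complete X\<close> \<open>v0 \<in> X\<close> self contr in auto)
    then show ?thesis using kQ(2) by blast
  qed
  moreover have "algebraically_simple_eigenvalue D (\<lambda>x. A x + \<kappa> *\<^sub>R B x) (l + of_real \<kappa> * \<phi> (B v))"
    if "v \<in> X" "perturbation_map B \<kappa> v = v" "\<bar>\<kappa>\<bar> * Q2 \<le> 1 / 2" for v \<kappa>
  proof (rule perturbed_simple[OF that(2) B KS(2,1) KB(2,1) K\<phi>(2,1)])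
    have "KS * KB + 2 * (K\<phi> * KB * (KS * norm v)) \<le> Q2"
      unfolding Q2_def using X_bound(2)[OF that(1)] KS(1) KB(1) K\<phi>(1)
      by (intro add_mono mult_left_mono order_refl) auto
    then have "\<bar>\<kappa>\<bar> * (KS * KB + 2 * (K\<phi> * KB * (KS * norm v))) \<le> \<bar>\<kappa>\<bar> * Q2"
      by (rule mult_left_mono) simp
    then show "\<bar>\<kappa>\<bar> * (KS * KB + 2 * (K\<phi> * KB * (KS * norm v))) < 1" using that(3) by linarith
  qed
  ultimately show ?thesis using \<delta> by (intro exI[of _ \<delta>]) (fastforce simp: X_def)
qed

text \<open>In the order of the complexification, a lower bound by a real vector forces
  \<open>v\<close> to be real. A complex \<open>B\<close> can move the eigenvector off the real
  part, so the bound is on \<open>real_part v\<close> in general and on \<open>v\<close> itself when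
  \<open>B\<close> is real.\<close>

theorem theorem1p2:
  fixes T :: "real \<Rightarrow> 'a::banach_lattice complexification \<Rightarrow> 'a complexification"
    and D :: "'a complexification set"
    and A B :: "'a complexification \<Rightarrow> 'a complexification"
    and u :: 'a
    and v0 :: "'a complexification"
    and \<mu>0 c :: real
  assumes semigroup: "C0_semigroup T"
    and generator: "generates D A T"
    and A_real: "real_operator D A"
    and u_pos: "0 \<le> u"
    and ultra: "ultracontractive T u"
    and bounded_on_ideal:
      "\<exists>C\<ge>1. \<forall>t\<in>{0<..1}. op_norm (gauge_norm u) (principal_ideal u) (gauge_norm u) (T t) \<le> ennreal C"
    and B_bounded: "bounded_clinear B"
    and B_invariant: "B ` principal_ideal u \<subseteq> principal_ideal u"
    and spec: "complex_of_real \<mu>0 \<in> spectrum D A"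
    and pole: "resolvent_has_pole D A (complex_of_real \<mu>0)"
    and simple: "algebraically_simple_eigenvalue D A (complex_of_real \<mu>0)"
    and v0_eigenvector: "eigenvector D A (complex_of_real \<mu>0) v0"
    and c_pos: "c > 0"
    and v0_lower: "of_re (c *\<^sub>R u) \<le> v0"
  shows "\<exists>\<delta>>0. \<forall>\<kappa>\<in>{-\<delta><..<\<delta>}. \<exists>\<mu> v.
           algebraically_simple_eigenvalue D (\<lambda>x. A x + \<kappa> *\<^sub>R B x) \<mu> \<and>
           eigenvector D (\<lambda>x. A x + \<kappa> *\<^sub>R B x) \<mu> v \<and>
           (c / 2) *\<^sub>R u \<le> real_part v \<and>
           (real_operator UNIV B \<longrightarrow> of_re ((c / 2) *\<^sub>R u) \<le> v)"
proof -
  obtain \<phi> S where sp: "simple_pole D A S (complex_of_real \<mu>0) v0 \<phi>"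
    by (rule simple_pole_exists[OF _ _ pole simple v0_eigenvector])
      (use generator_linear[OF semigroup generator] in blast)+
  interpret simple_pole D A S "complex_of_real \<mu>0" v0 \<phi> by (rule sp)
  obtain C \<alpha> where C: "1 \<le> C" "0 < \<alpha>" and ultra': "\<And>t. 0 < t \<Longrightarrow> t \<le> 1 \<Longrightarrow>
      range (T t) \<subseteq> principal_ideal u \<and>
      op_norm norm UNIV (gauge_norm u) (T t) \<le> ennreal (C * t powr (- \<alpha>))"
    using ultra unfolding ultracontractive_def by auto
  obtain C' where C': "1 \<le> C'" and ideal': "\<And>t. 0 < t \<Longrightarrow> t \<le> 1 \<Longrightarrow>
      op_norm (gauge_norm u) (principal_ideal u) (gauge_norm u) (T t) \<le> ennreal C'"
    using bounded_on_ideal by auto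
  have linT: "linear (T t)" if "0 < t" for t
    using semigroup that by (simp add: C0_semigroup_def bounded_clinear_def bounded_linear.linear)
  have est: "modulus y \<le> (exp \<bar>\<mu>0\<bar> * (C * norm y + C' * k)) *\<^sub>R u"
    if "y \<in> D" "0 \<le> k" "modulus (\<mu>0 *\<^sub>R y - A y) \<le> k *\<^sub>R u" for y k
  proof (rule modulus_le_of_generator[OF semigroup generator that(1) u_pos refl])
    fix t :: real and x k assume t: "0 < t" "t \<le> 1"
    show "modulus (T t x) \<le> (C * t powr (- \<alpha>) * norm x) *\<^sub>R u"
      using ultra'[OF t] linT[OF t(1)] u_pos C by (intro modulus_le_of_op_norm) auto
    assume "0 \<le> k" "modulus x \<le> k *\<^sub>R u"
    then show "modulus (T t x) \<le> (C' * k) *\<^sub>R u"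
      using ultra'[OF t] ideal'[OF t] linT[OF t(1)] u_pos C'
      by (intro modulus_le_of_op_norm_gauge) auto
  qed (use C C' that in auto)
  \<comment> \<open>The estimate with \<open>k = 0\<close>, since
    \<open>(\<mu>0 - A) v0 = 0\<close>; in particular \<open>v0\<close> lies in
    \<open>E_u\<close>.\<close>
  define k0 where "k0 = exp \<bar>\<mu>0\<bar> * (C * norm v0)"
  have k0: "0 \<le> k0" "modulus v0 \<le> k0 *\<^sub>R u"
    using est[OF v0_mem, of 0] C by (simp_all add: k0_def A_v0 scaleC_of_real)
  obtain KS where KS: "0 \<le> KS" "\<And>x. norm (S x) \<le> KS * norm x"
    using bounded_linear.nonneg_bounded[OF S_bounded] by (auto simp: mult.commute)
  obtain K\<phi> where K\<phi>: "0 \<le> K\<phi>" "\<And>x. cmod (\<phi> x) \<le> K\<phi> * norm x"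
    using \<phi>_bounded by blast
  \<comment> \<open>The estimate \<open>est\<close> for \<open>y = S x\<close> with right-hand side
    \<open>x - \<phi> x v0\<close>: a gauge bound \<open>k\<close> on \<open>x\<close> gives
    \<open>norm x \<le> k * norm u\<close>, which controls \<open>norm (S x)\<close> and
    \<open>\<phi> x\<close>.\<close>
  define K1 where "K1 = exp \<bar>\<mu>0\<bar> * (C * (KS * norm u) + C' * (1 + K\<phi> * norm u * k0))"
  have K1: "0 \<le> K1" using C C' KS(1) K\<phi>(1) k0(1) by (simp add: K1_def)
  have gS: "modulus (S x) \<le> (K1 * k) *\<^sub>R u" if x: "0 \<le> k" "modulus x \<le> k *\<^sub>R u" for x k
  proof -
    have nx: "norm x \<le> k * norm u" using norm_le_of_modulus_le[OF x(2)] x(1) by simp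
    have "cmod (\<phi> x) \<le> K\<phi> * (k * norm u)"
      using K\<phi>(2)[of x] mult_left_mono[OF nx K\<phi>(1)] by linarith
    then have "cmod (\<phi> x) *\<^sub>R modulus v0 \<le> (K\<phi> * (k * norm u)) *\<^sub>R (k0 *\<^sub>R u)"
      using k0 K\<phi>(1) x(1) by (intro scaleR_mono) auto
    then have "modulus x + modulus (\<phi> x *\<^sub>C v0) \<le> k *\<^sub>R u + (K\<phi> * (k * norm u)) *\<^sub>R (k0 *\<^sub>R u)"
      using x(2) by (simp add: modulus_scaleC add_mono)
    then have "modulus (x - \<phi> x *\<^sub>C v0) \<le> k *\<^sub>R u + (K\<phi> * (k * norm u)) *\<^sub>R (k0 *\<^sub>R u)"
      using modulus_diff_le order_trans by blast
    then have "modulus (\<mu>0 *\<^sub>R S x - A (S x)) \<le> (k * (1 + K\<phi> * norm u * k0)) *\<^sub>R u"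
      using S_right[of x] by (simp add: scaleC_of_real distrib_left scaleR_add_left mult_ac)
    then have "modulus (S x)
        \<le> (exp \<bar>\<mu>0\<bar> * (C * norm (S x) + C' * (k * (1 + K\<phi> * norm u * k0)))) *\<^sub>R u"
      using x(1) K\<phi>(1) k0(1) by (intro est S_range) auto
    moreover have "exp \<bar>\<mu>0\<bar> * (C * norm (S x) + C' * (k * (1 + K\<phi> * norm u * k0))) \<le> K1 * k"
    proof -
      have "norm (S x) \<le> KS * (k * norm u)"
        using KS(2)[of x] mult_left_mono[OF nx KS(1)] by linarith
      then have "exp \<bar>\<mu>0\<bar> * (C * norm (S x) + C' * (k * (1 + K\<phi> * norm u * k0)))
          \<le> exp \<bar>\<mu>0\<bar> * (C * (KS * (k * norm u)) + C' * (k * (1 + K\<phi> * norm u * k0)))"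
        using C by (intro mult_left_mono add_right_mono) auto
      then show ?thesis by (simp add: K1_def algebra_simps)
    qed
    ultimately show ?thesis by (rule modulus_le_scaleR_mono[OF _ _ u_pos])
  qed
  have "bounded_linear B" using B_bounded by (simp add: bounded_clinear_def)
  then obtain K2 where K2: "0 \<le> K2"
    "\<And>x k. 0 \<le> k \<Longrightarrow> modulus x \<le> k *\<^sub>R u \<Longrightarrow> modulus (B x) \<le> (K2 * k) *\<^sub>R u"
    using bounded_on_principal_ideal[OF u_pos _ B_invariant] by blast
  have v0_real: "imag_part v0 = 0" and v0_le: "c *\<^sub>R u \<le> real_part v0"
    using v0_lower by (auto simp: less_eq_complexification_def)
  \<comment> \<open>The real part if \<open>B\<close> is real, the whole space otherwise.\<close>
  define Z where "Z = {v :: 'a complexification. real_operator UNIV B \<longrightarrow> imag_part v = 0}"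
  have Z_closed: "closed Z"
  proof -
    have "closed (imag_part -` {0 :: 'a})"
      by (intro closed_vimage linear_continuous_on bounded_linear_imag_part) simp
    then show ?thesis by (cases "real_operator UNIV B") (simp_all add: Z_def vimage_def)
  qed
  have Z_map: "perturbation_map B \<kappa> v \<in> Z" if v: "v \<in> Z" for \<kappa> v
  proof -
    have "imag_part (perturbation_map B \<kappa> v) = 0" if rB: "real_operator UNIV B"
    proof -
      have "imag_part v = 0" using v rB by (simp add: Z_def)
      moreover have "imag_part (B v) = 0"
        using rB \<open>imag_part v = 0\<close> by (auto simp: real_operator_def mem_real_space_iff image_subset_iff)
      ultimately show ?thesis
        using \<phi>_S_real[OF A_real _ v0_real] by (simp add: perturbation_map_def v0_real)
    qed
    then show ?thesis by (simp add: Z_def)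
  qed
  \<comment> \<open>With radius \<open>c / 2\<close>, half of the lower bound \<open>c u\<close> for
    \<open>v0\<close> survives.\<close>
  obtain \<delta> where \<delta>: "0 < \<delta>" "\<And>\<kappa>. \<bar>\<kappa>\<bar> < \<delta> \<Longrightarrow> \<exists>v\<in>Z. modulus (v - v0) \<le> (c / 2) *\<^sub>R u \<and>
      perturbation_map B \<kappa> v = v \<and> algebraically_simple_eigenvalue D (\<lambda>x. A x + \<kappa> *\<^sub>R B x)
        (complex_of_real \<mu>0 + of_real \<kappa> * \<phi> (B v))"
    using perturbed_eigenvector_exists[OF B_bounded u_pos _ K1 gS K2 k0 Z_closed _ Z_map, of "c / 2"]
      c_pos v0_real by (auto simp: Z_def)
  show ?thesis
  proof (intro exI[of _ \<delta>] conjI ballI)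
    fix \<kappa> assume "\<kappa> \<in> {-\<delta><..<\<delta>}"
    then have "\<bar>\<kappa>\<bar> < \<delta>" by auto
    then obtain v where v: "v \<in> Z" "modulus (v - v0) \<le> (c / 2) *\<^sub>R u" "perturbation_map B \<kappa> v = v"
      "algebraically_simple_eigenvalue D (\<lambda>x. A x + \<kappa> *\<^sub>R B x)
        (complex_of_real \<mu>0 + of_real \<kappa> * \<phi> (B v))"
      using \<delta>(2) by blast
    have "- real_part (v - v0) \<le> modulus (v - v0)"
      using abs_real_part_le_modulus[of "v - v0"] by (simp add: abs_le_iff)
    also note v(2)
    finally have "real_part v0 - (c / 2) *\<^sub>R u \<le> real_part v" by (simp add: algebra_simps)
    moreover have "c *\<^sub>R u = (c / 2) *\<^sub>R u + (c / 2) *\<^sub>R u" 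
      using scaleR_add_left[of "c / 2" "c / 2" u] by simp
    ultimately have "(c / 2) *\<^sub>R u \<le> real_part v"
      using v0_le by (simp add: le_diff_eq[symmetric] order_trans)
    then show "\<exists>\<mu> v. algebraically_simple_eigenvalue D (\<lambda>x. A x + \<kappa> *\<^sub>R B x) \<mu> \<and>
        eigenvector D (\<lambda>x. A x + \<kappa> *\<^sub>R B x) \<mu> v \<and> (c / 2) *\<^sub>R u \<le> real_part v \<and>
        (real_operator UNIV B \<longrightarrow> of_re ((c / 2) *\<^sub>R u) \<le> v)"
      using v perturbation_map_fixed_point(1)[OF v(3)]
      by (auto simp: Z_def less_eq_complexification_def)
  qed (rule \<delta>(1))
qed

end
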